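(* Let $0<\alpha<1$. For every positive integer $k$, $c_{k+1}(k)<\infty$. Suppose moreover that $k$ is a positive integer with $0<\alpha<k/(k+2)$ and that $$M_n^{1-\frac{\alpha(k+2)}{k}-\gamma}\gg n^{1/\alpha}$$ for some $0<\gamma<1-\frac{\alpha(k+2)}{k}$. Then, as $n\to\infty$, $$P(S_n>kM_n)\sim\frac{c_{k+1}(k)}{(k+1)!}\,n^{k+1}\,P(Y>M_n)^{k+1}.$$
   Context: Let $0<\alpha<1$ and let $Y,Y_1,Y_2,\ldots$ be i.i.d. real random variables such that $x\mapsto P(|Y|>x)$ is regularly varying at infinity with index $-\alpha$, and such that $p:=\lim_{x\to\infty}\frac{P(Y>x)}{P(|Y|>x)}$ exists and is positive. Assume that for every $\delta>0$ there exist $T_0>0$ and $u_0\in(0,1)$ such that for all $T\ge T_0$ and all $1-u_0\le a\le b\le1$, $$\left|\frac{P(Y>aT)-P(Y>bT)}{P(Y>T)}-(a^{-\alpha}-b^{-\alpha})\right|\le\delta(b-a).$$ Let $(M_n)$ be a sequence of positive numbers, $X_{nj}:=Y_j\mathbf 1(|Y_j|\le M_n)$ for $1\le j\le n$, and $S_n:=\sum_{j=1}^nX_{nj}$. For positive sequences, $u_n\gg v_n$ means $\lim_{n\to\infty}u_n/v_n=\infty$, and $u_n\sim v_n$ means $\lim_{n\to\infty} u_n/v_n=1$. For $k\ge1$ the functions $c_k:[k-1,k]\to[0,\infty]$ are defined recursively by $$c_1(t)=t^{-\alpha}-1,\quad 0\le t\le1,$$ $$c_{k+1}(t)=\alpha\int_{t-k}^1c_k(t-z)\,z^{-\alpha-1}\,dz,\quad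 k\le t\le k+1,\ k\ge1,$$ with the convention $0^{-\alpha}=\infty$. *)

theory Defs
  imports "HOL-Probability.Probability"
begin

definition regularly_varying :: "(real \<Rightarrow> real) \<Rightarrow> real \<Rightarrow> bool" where
  "regularly_varying f \<rho> \<longleftrightarrow>
     (\<exists>a. (\<forall>x\<ge>a. 0 < f x) \<and> set_borel_measurable borel {a..} f) \<and>
     (\<forall>s>0. ((\<lambda>x. f (s * x) / f x) \<longlongrightarrow> s powr \<rho>) at_top)"

definition iid_real :: "'a measure \<Rightarrow> (nat \<Rightarrow> 'a \<Rightarrow> real) \<Rightarrow> bool" where
  "iid_real P Y \<longleftrightarrow>
     prob_space.indep_vars P (\<lambda>_. borel) Y UNIV \<and>
     (\<forall>j. distr P borel (Y j) = distr P borel (Y 0))"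

definition local_tail_regularity :: "real \<Rightarrow> 'a measure \<Rightarrow> ('a \<Rightarrow> real) \<Rightarrow> bool" where
  "local_tail_regularity \<alpha> P Z \<longleftrightarrow>
     (\<forall>\<delta>>0. \<exists>T0>0. \<exists>u0. 0 < u0 \<and> u0 < 1 \<and>
        (\<forall>T\<ge>T0. \<forall>a b. 1 - u0 \<le> a \<and> a \<le> b \<and> b \<le> 1 \<longrightarrow>
           \<bar>(\<P>(\<omega> in P. Z \<omega> > a * T) - \<P>(\<omega> in P. Z \<omega> > b * T)) / \<P>(\<omega> in P. Z \<omega> > T)
             - (a powr (-\<alpha>) - b powr (-\<alpha>))\<bar> \<le> \<delta> * (b - a)))"

definition truncated_sum :: "(nat \<Rightarrow> 'a \<Rightarrow> real) \<Rightarrow> (nat \<Rightarrow> real) \<Rightarrow> nat \<Rightarrow> 'a \<Rightarrow> real" where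
  "truncated_sum Y M n \<omega> = (\<Sum>j=1..n. Y j \<omega> * indicator {y. \<bar>y\<bar> \<le> M n} (Y j \<omega>))"

definition much_greater :: "(nat \<Rightarrow> real) \<Rightarrow> (nat \<Rightarrow> real) \<Rightarrow> bool" where
  "much_greater u v \<longleftrightarrow> filterlim (\<lambda>n. u n / v n) at_top sequentially"

text \<open>The function \<open>c_fun \<alpha> k\<close> is meaningful only for \<open>k \<ge> 1\<close> and arguments in \<open>[k - 1, k]\<close>.
  Its values elsewhere are junk, and the recursion never uses them: for \<open>t\<close> in \<open>[k, k + 1]\<close> and
  \<open>z\<close> in \<open>[t - k, 1]\<close>, the point \<open>t - z\<close> lies in \<open>[k - 1, k]\<close>.
  The case \<open>t = 0\<close> is separate because the library has \<open>0 powr a = 0\<close>.\<close>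

fun c_fun :: "real \<Rightarrow> nat \<Rightarrow> real \<Rightarrow> ennreal" where
  "c_fun \<alpha> 0 t = 0"
| "c_fun \<alpha> (Suc 0) t = (if t = 0 then \<infinity> else ennreal (t powr (-\<alpha>) - 1))"
| "c_fun \<alpha> (Suc (Suc k)) t =
     ennreal \<alpha> * (\<integral>\<^sup>+ z \<in> {t - real (Suc k)..1}.
       (c_fun \<alpha> (Suc k) (t - z) * ennreal (z powr (-\<alpha> - 1))) \<partial>lborel)"

end

theory Submission
  imports Defs
begin

text \<open>
  Write $q_n = P(Y > M_n)$; the growth condition on $M_n$ gives $n q_n \to 0$. Fix a small
  $\epsilon > 0$ and call a summand big if it lies in $(\epsilon M_n, M_n]$. By a Chernoff bound the
  sum of the positive summands that are not big exceeds a fixed multiple of $M_n$ with probability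
  $O((n q_n)^r)$, where $r$ is as large as we please for small $\epsilon$; hence $S_n > k M_n$
  essentially requires at least $k$ big summands.

  If there are $k+1$ of them, regular variation yields the main term, because the rescaled big
  summands behave like independent points with intensity $\alpha z^{-\alpha-1} dz$ on
  $(\epsilon, 1]$ and the other summands add up to $o(M_n)$.
  If there are exactly $k$, each of them is within $R$ of $M_n$, where $R$ is the sum of the small
  positive summands. By the local condition this has conditional probability at most
  $(C q_n R / M_n)^k$, which is at most $(C q_n)^k R / M_n$ when $R \le M_n$, and
  $E R / M_n = O(\epsilon^{1-\alpha} n q_n)$ by Karamata's theorem. This contribution disappears
  as $\epsilon \to 0$.

  For the lower bound, the events that the big summands are those in a given $(k+1)$-set, that
  their sum exceeds $(k + \epsilon) M_n$, and that the absolute values of the others sum to at most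
  $\epsilon M_n$, are disjoint.
\<close>

text \<open>The level k is exactly what k summands of full size M_n reach. In the limit k jumps have
  no mass beyond k, but the bound for exactly k big summands plus a small excess has the order (n
  q_n)^(k+1) of the main term, with a coefficient of size \<epsilon>^(1-\<alpha>). Hence the order
  of choices: first \<epsilon>, then shifts \<delta> depending on \<epsilon>, then n. Errors of
  order (n q_n)^(k+2) may carry coefficients that blow up as \<epsilon> tends to 0, since n is
  chosen last; the Chernoff exponents are picked to reach this order.

  Regular variation gives no rate for windows of width o(M_n) below M_n; the local condition
  supplies one that is linear in the width, which matches a first-moment bound for R.

  The functions c_j live on [j-1,j] only and start from c_1(0) = infinity. Tails of convolution
  powers extend them to monotone functions on the line. A cutoff \<epsilon> > 0 makes these finite,
  and Lipschitz from the first power on, so shifts of the level cost little. The cutoff is removed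
  by monotonicity in the upper bound and by monotone convergence in the lower one.\<close>

section \<open>Tails of convolution powers\<close>

text \<open>
  \<open>conv_tail \<nu> j t\<close> is the mass that the \<open>j\<close>-fold convolution power of \<open>\<nu>\<close> gives to the
  half-line \<open>{t<..}\<close>. For \<open>\<nu> = jump_measure \<alpha> 0\<close> it is the function $c_j$ on $[j-1,j]$.
\<close>

fun conv_tail :: "real measure \<Rightarrow> nat \<Rightarrow> real \<Rightarrow> ennreal" where
  "conv_tail \<nu> 0 t = (if t < 0 then 1 else 0)"
| "conv_tail \<nu> (Suc j) t = (\<integral>\<^sup>+z. conv_tail \<nu> j (t - z) \<partial>\<nu>)"

lemma conv_tail_antimono: "s \<le> t \<Longrightarrow> conv_tail \<nu> j t \<le> conv_tail \<nu> j s"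
proof (induction j arbitrary: s t)
  case (Suc j)
  then show ?case by (auto intro!: nn_integral_mono)
qed auto

lemma borel_measurable_antimono_ennreal:
  fixes f :: "real \<Rightarrow> ennreal"
  assumes "\<And>s t. s \<le> t \<Longrightarrow> f t \<le> f s"
  shows "f \<in> borel_measurable borel"
proof -
  have "is_interval {x. y < f x}" for y
    using assms by (auto simp: is_interval_1) (meson less_le_trans)
  then have "{x. y < f x} \<in> sets borel" for y
    by (rule real_interval_borel_measurable)
  then show ?thesis
    by (intro borel_measurableI_greater) auto
qed

text \<open>Monotonicity needs nothing about \<open>\<nu>\<close>, so this avoids any measurability
  argument through the recursion, also when \<open>\<nu>\<close> has infinite mass.\<close>

lemma borel_measurable_conv_tail [measurable]: "conv_tail \<nu> j \<in> borel_measurable borel"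
  by (rule borel_measurable_antimono_ennreal) (rule conv_tail_antimono)

lemma conv_tail_le_power: "conv_tail \<nu> j t \<le> emeasure \<nu> (space \<nu>) ^ j"
proof (induction j arbitrary: t)
  case (Suc j)
  have "conv_tail \<nu> (Suc j) t \<le> (\<integral>\<^sup>+z. emeasure \<nu> (space \<nu>) ^ j \<partial>\<nu>)"
    unfolding conv_tail.simps by (intro nn_integral_mono Suc.IH)
  then show ?case by (simp add: mult.commute)
qed auto

text \<open>This is the limit of the law of Y / M_n, restricted to (\<epsilon>,1] and divided by
  q_n. The mass near 0 is infinite for \<open>\<epsilon> = 0\<close>; a positive cutoff makes it
  finite, and the probabilistic estimates all work with a positive cutoff.\<close>

definition jump_measure :: "real \<Rightarrow> real \<Rightarrow> real measure" where
  "jump_measure \<alpha> \<epsilon> = density lborel (\<lambda>z. ennreal (\<alpha> * z powr (-\<alpha> - 1)) * indicator {\<epsilon><..1} z)"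

lemma sets_jump_measure [simp, measurable_cong]: "sets (jump_measure \<alpha> \<epsilon>) = sets borel"
  and space_jump_measure [simp]: "space (jump_measure \<alpha> \<epsilon>) = UNIV"
  by (simp_all add: jump_measure_def)

lemma nn_integral_jump_measure:
  assumes [measurable]: "f \<in> borel_measurable borel"
  shows "(\<integral>\<^sup>+z. f z \<partial>jump_measure \<alpha> \<epsilon>) =
    (\<integral>\<^sup>+z. ennreal (\<alpha> * z powr (-\<alpha> - 1)) * indicator {\<epsilon><..1} z * f z \<partial>lborel)"
  unfolding jump_measure_def by (rule nn_integral_density) auto

lemma conv_tail_jump_Suc:
  "conv_tail (jump_measure \<alpha> \<epsilon>) (Suc j) t =
    (\<integral>\<^sup>+z. ennreal (\<alpha> * z powr (-\<alpha> - 1)) * indicator {\<epsilon><..1} z *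
       conv_tail (jump_measure \<alpha> \<epsilon>) j (t - z) \<partial>lborel)"
  by (simp add: nn_integral_jump_measure)

lemma emeasure_jump_measure:
  assumes "\<epsilon> \<le> a" "0 < a" "a \<le> b" "b \<le> 1" "0 < \<alpha>"
  shows "emeasure (jump_measure \<alpha> \<epsilon>) {a<..b} = ennreal (a powr -\<alpha> - b powr -\<alpha>)"
proof -
  have "emeasure (jump_measure \<alpha> \<epsilon>) {a<..b} =
     (\<integral>\<^sup>+z. ennreal (\<alpha> * z powr (-\<alpha> - 1)) * indicator {a<..b} z \<partial>lborel)"
    unfolding jump_measure_def using assms
    by (subst emeasure_density) (auto intro!: nn_integral_cong split: split_indicator)
  also have "\<dots> = (\<integral>\<^sup>+z. ennreal (\<alpha> * z powr (-\<alpha> - 1)) * indicator {a..b} z \<partial>lborel)"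
    by (intro nn_integral_cong_AE, rule AE_mp[OF AE_lborel_singleton[of a]])
       (auto split: split_indicator)
  also have "\<dots> = ennreal (- (b powr -\<alpha>) - (- (a powr -\<alpha>)))"
    using assms
    by (intro nn_integral_FTC_Icc)
       (auto intro!: derivative_eq_intros simp: has_real_derivative_iff_has_vector_derivative[symmetric] powr_diff powr_minus field_simps)
  finally show ?thesis by simp
qed

lemma emeasure_jump_measure_UNIV:
  assumes "0 < \<alpha>" "0 < \<epsilon>" "\<epsilon> \<le> 1"
  shows "emeasure (jump_measure \<alpha> \<epsilon>) UNIV = ennreal (\<epsilon> powr -\<alpha> - 1)"
proof -
  have "emeasure (jump_measure \<alpha> \<epsilon>) UNIV = emeasure (jump_measure \<alpha> \<epsilon>) {\<epsilon><..1}"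
    unfolding jump_measure_def using assms
    by (subst (1 2) emeasure_density) (auto intro!: nn_integral_cong split: split_indicator)
  then show ?thesis
    using emeasure_jump_measure[of \<epsilon> \<epsilon> 1 \<alpha>] assms by simp
qed

lemma conv_tail_jump_finite:
  assumes "0 < \<alpha>" "0 < \<epsilon>" "\<epsilon> \<le> 1"
  shows "conv_tail (jump_measure \<alpha> \<epsilon>) j t < \<infinity>"
proof -
  have "emeasure (jump_measure \<alpha> \<epsilon>) (space (jump_measure \<alpha> \<epsilon>)) ^ j < \<infinity>"
    using emeasure_jump_measure_UNIV[OF assms] by (simp add: power_less_top_ennreal)
  then show ?thesis using conv_tail_le_power[of "jump_measure \<alpha> \<epsilon>" j t] by (rule le_less_trans[rotated])
qed

text \<open>Jumps are at most 1, so \<open>j\<close> of them cannot add up to more than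
  \<open>j\<close>.\<close>

lemma conv_tail_jump_eq_0: "real j \<le> t \<Longrightarrow> conv_tail (jump_measure \<alpha> \<epsilon>) j t = 0"
proof (induction j arbitrary: t)
  case (Suc j)
  have "(\<integral>\<^sup>+z. ennreal (\<alpha> * z powr (-\<alpha> - 1)) * indicator {\<epsilon><..1} z *
       conv_tail (jump_measure \<alpha> \<epsilon>) j (t - z) \<partial>lborel) = (\<integral>\<^sup>+z. 0 \<partial>(lborel :: real measure))"
    using Suc by (intro nn_integral_cong) (auto split: split_indicator)
  then show ?case unfolding conv_tail_jump_Suc by simp
qed auto

lemma conv_tail_jump_mono:
  assumes "\<epsilon> \<le> \<epsilon>'"
  shows "conv_tail (jump_measure \<alpha> \<epsilon>') j t \<le> conv_tail (jump_measure \<alpha> \<epsilon>) j t"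
proof (induction j arbitrary: t)
  case (Suc j)
  then show ?case unfolding conv_tail_jump_Suc using assms
    by (intro nn_integral_mono mult_mono) (auto split: split_indicator)
qed auto

text \<open>If \<open>j\<close> jumps exceed j - 1 + \<epsilon> in total, then each of them exceeds
  \<epsilon>, since the others contribute at most j - 1. The cutoff then discards nothing.\<close>

lemma conv_tail_jump_eq:
  assumes "0 \<le> \<epsilon>" "real j - 1 + \<epsilon> \<le> t"
  shows "conv_tail (jump_measure \<alpha> \<epsilon>) j t = conv_tail (jump_measure \<alpha> 0) j t"
  using assms(2)
proof (induction j arbitrary: t)
  case (Suc j)
  have "conv_tail (jump_measure \<alpha> 0) j (t - z) = 0" if "z \<le> \<epsilon>" for z
    using Suc.prems that by (intro conv_tail_jump_eq_0) auto
  moreover have "conv_tail (jump_measure \<alpha> \<epsilon>) j (t - z) = conv_tail (jump_measure \<alpha> 0) j (t - z)" if "z \<le> 1" for z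
    using Suc.prems that by (intro Suc.IH) auto
  ultimately show ?case unfolding conv_tail_jump_Suc using \<open>0 \<le> \<epsilon>\<close>
    by (intro nn_integral_cong) (auto split: split_indicator)
qed auto

text \<open>On (\<epsilon>,1] the density is at most \<alpha> \<epsilon>^(-\<alpha>-1), which
  settles one jump; each further convolution multiplies the constant by the total mass. With no jump
  the tail is a step function, hence the form \<open>Suc j\<close>.\<close>

lemma conv_tail_jump_Lipschitz:
  assumes "0 < \<alpha>" "0 < \<epsilon>" "\<epsilon> \<le> 1"
  shows "\<exists>C\<ge>0. \<forall>t. \<forall>h\<ge>0. conv_tail (jump_measure \<alpha> \<epsilon>) (Suc j) (t - h) \<le>
     conv_tail (jump_measure \<alpha> \<epsilon>) (Suc j) t + ennreal (C * h)"
proof (induction j)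
  case 0
  define C where "C = \<alpha> * \<epsilon> powr (-\<alpha> - 1)"
  have [measurable]: "(\<lambda>z. if t - z < 0 then 1 else 0) \<in> borel_measurable borel" for t :: real
    by measurable
  have "conv_tail (jump_measure \<alpha> \<epsilon>) (Suc 0) (t - h) \<le>
     conv_tail (jump_measure \<alpha> \<epsilon>) (Suc 0) t + ennreal (C * h)" if "h \<ge> 0" for t h
  proof -
    have "conv_tail (jump_measure \<alpha> \<epsilon>) (Suc 0) (t - h) \<le>
      (\<integral>\<^sup>+z. ennreal (\<alpha> * z powr (-\<alpha> - 1)) * indicator {\<epsilon><..1} z * (if t - z < 0 then 1 else 0)
         + ennreal C * indicator {t - h..t} z \<partial>lborel)"
      unfolding conv_tail_jump_Suc
    proof (intro nn_integral_mono)
      fix z :: real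
      let ?w = "ennreal (\<alpha> * z powr (-\<alpha> - 1)) * indicator {\<epsilon><..1} z"
      have w: "?w \<le> ennreal C"
      proof (cases "\<epsilon> < z \<and> z \<le> 1")
        case True
        then have "\<alpha> * z powr (-\<alpha> - 1) \<le> C"
          unfolding C_def using assms by (intro mult_left_mono powr_mono2') auto
        then show ?thesis using True by (simp add: ennreal_leI)
      qed auto
      consider "z \<le> t - h" | "t < z" | "t - h \<le> z" "z \<le> t" by linarith
      then show "?w * conv_tail (jump_measure \<alpha> \<epsilon>) 0 (t - h - z) \<le>
         ?w * (if t - z < 0 then 1 else 0) + ennreal C * indicator {t - h..t} z"
      proof cases
        case 3
        have "?w * conv_tail (jump_measure \<alpha> \<epsilon>) 0 (t - h - z) \<le> ennreal C * 1"
          by (intro mult_mono w) auto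
        with 3 show ?thesis by simp
      qed (use that in auto)
    qed
    also have "\<dots> = conv_tail (jump_measure \<alpha> \<epsilon>) (Suc 0) t + ennreal (C * h)"
      unfolding conv_tail_jump_Suc using assms that
      by (subst nn_integral_add) (measurable, simp add: nn_integral_cmult C_def ennreal_mult)
    finally show ?thesis .
  qed
  moreover have "C \<ge> 0" using assms by (simp add: C_def)
  ultimately show ?case by blast
next
  case (Suc j)
  let ?\<nu> = "jump_measure \<alpha> \<epsilon>"
  obtain C where C: "C \<ge> 0" "\<And>t h. h \<ge> 0 \<Longrightarrow> conv_tail ?\<nu> (Suc j) (t - h) \<le> conv_tail ?\<nu> (Suc j) t + ennreal (C * h)"
    using Suc by blast
  define V where "V = \<epsilon> powr -\<alpha> - 1"
  have V: "V \<ge> 0" "emeasure ?\<nu> UNIV = ennreal V"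
    using assms emeasure_jump_measure_UNIV[OF assms] powr_mono2'[of "-\<alpha>" \<epsilon> 1]
    by (simp_all add: V_def)
  have "conv_tail ?\<nu> (Suc (Suc j)) (t - h) \<le> conv_tail ?\<nu> (Suc (Suc j)) t + ennreal (C * V * h)" if "h \<ge> 0" for t h
  proof -
    have "conv_tail ?\<nu> (Suc (Suc j)) (t - h) \<le> (\<integral>\<^sup>+z. conv_tail ?\<nu> (Suc j) (t - z) + ennreal (C * h) \<partial>?\<nu>)"
      unfolding conv_tail.simps(2)[of ?\<nu> "Suc j"]
    proof (intro nn_integral_mono)
      show "conv_tail ?\<nu> (Suc j) (t - h - z) \<le> conv_tail ?\<nu> (Suc j) (t - z) + ennreal (C * h)" for z
        using C(2)[OF that, of "t - z"] by (simp only: diff_diff_add add.commute[of h z])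
    qed
    also have "\<dots> = conv_tail ?\<nu> (Suc (Suc j)) t + ennreal (C * h) * ennreal V"
      unfolding conv_tail.simps(2)[of ?\<nu> "Suc j"]
      by (subst nn_integral_add) (measurable, simp add: V del: conv_tail.simps)
    also have "ennreal (C * h) * ennreal V = ennreal (C * V * h)"
      using C(1) V that by (simp add: ennreal_mult[symmetric] mult_ac)
    finally show ?thesis .
  qed
  then show ?case using C(1) V(1) by (intro exI[of _ "C * V"]) auto
qed

text \<open>The condition that the sum exceeds \<open>t\<close> is open, so a level slightly above
  \<open>t\<close> and a cutoff slightly above 0 can be imposed together without loss in the
  supremum. The lower bound needs room of both kinds.\<close>

lemma SUP_conv_tail_jump:
  "(SUP n. conv_tail (jump_measure \<alpha> (1 / real (Suc n))) j (t + 1 / real (Suc n))) =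
    conv_tail (jump_measure \<alpha> 0) j t"
proof (induction j arbitrary: t)
  case 0
  show ?case
  proof (cases "t < 0")
    case True
    obtain n where "1 / real (Suc n) < - t" using True reals_Archimedean[of "-t"] by (auto simp: field_simps)
    then have "1 \<le> (SUP n. conv_tail (jump_measure \<alpha> (1 / real (Suc n))) 0 (t + 1 / real (Suc n)))"
      by (intro SUP_upper2[of n]) auto
    moreover have "(SUP n. conv_tail (jump_measure \<alpha> (1 / real (Suc n))) 0 (t + 1 / real (Suc n))) \<le> 1"
      by (intro SUP_least) auto
    ultimately show ?thesis using True by auto
  next
    case False
    then have "conv_tail (jump_measure \<alpha> (1 / real (Suc n))) 0 (t + 1 / real (Suc n)) = 0" for n
      by (auto simp: not_less intro!: add_nonneg_nonneg)
    then show ?thesis using False by auto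
  qed
next
  case (Suc j)
  define f where "f = (\<lambda>n z. conv_tail (jump_measure \<alpha> (1 / real (Suc n))) j (t + 1 / real (Suc n) - z))"
  define w where "w = (\<lambda>n z. ennreal (\<alpha> * z powr (-\<alpha> - 1)) * indicator {1 / real (Suc n)<..1} z)"
  have inc: "1 / real (Suc n) \<le> 1 / real (Suc m)" if "m \<le> n" for m n
    using that by (simp add: frac_le)
  have f_mono: "f m z \<le> f n z" if "m \<le> n" for m n z
  proof -
    have "f m z \<le> conv_tail (jump_measure \<alpha> (1 / real (Suc n))) j (t + 1 / real (Suc m) - z)"
      unfolding f_def by (intro conv_tail_jump_mono inc that)
    also have "\<dots> \<le> f n z"
      unfolding f_def using inc[OF that] by (intro conv_tail_antimono) auto
    finally show ?thesis .
  qed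
  have w_mono: "w m z \<le> w n z" if "m \<le> n" for m n z
    unfolding w_def using inc[OF that] by (intro mult_left_mono) (auto split: split_indicator)
  have f_SUP: "(SUP n. f n z) = conv_tail (jump_measure \<alpha> 0) j (t - z)" for z
    using Suc.IH[of "t - z"] by (simp add: f_def algebra_simps)
  have w_SUP: "(SUP n. w n z) = ennreal (\<alpha> * z powr (-\<alpha> - 1)) * indicator {0<..1} z" for z
  proof -
    have "(SUP n. w n z) = ennreal (\<alpha> * z powr (-\<alpha> - 1)) * (SUP n. indicator {1 / real (Suc n)<..1} z)"
      unfolding w_def by (rule SUP_mult_left_ennreal[symmetric])
    also have "(SUP n. indicator {1 / real (Suc n)<..1} z) = (indicator {0<..1} z :: ennreal)"
    proof (cases "0 < z \<and> z \<le> 1")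
      case True
      obtain n where "1 / real (Suc n) < z" using True reals_Archimedean[of z] by (auto simp: field_simps)
      then show ?thesis using True
        by (intro antisym SUP_least SUP_upper2[of n]) (auto split: split_indicator)
    next
      case False
      then have "indicator {1 / real (Suc n)<..1} z = (0 :: ennreal)" for n
        using less_trans[of 0 "1 / real (Suc n)" z] by (auto split: split_indicator)
      then show ?thesis using False by auto
    qed
    finally show ?thesis .
  qed
  have [measurable]: "f n \<in> borel_measurable borel" "w n \<in> borel_measurable borel" for n
    unfolding f_def w_def by measurable
  have "conv_tail (jump_measure \<alpha> 0) (Suc j) t = (\<integral>\<^sup>+z. (SUP n. w n z * f n z) \<partial>lborel)"
    unfolding conv_tail_jump_Suc
  proof (intro nn_integral_cong)
    fix z
    show "ennreal (\<alpha> * z powr (-\<alpha> - 1)) * indicator {0<..1} z * conv_tail (jump_measure \<alpha> 0) j (t - z) =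
       (SUP n. w n z * f n z)"
      unfolding f_SUP[symmetric] w_SUP[symmetric]
    proof (subst SUP_mult_left_ennreal, subst SUP_mult_right_ennreal, rule antisym)
      show "(SUP i. SUP ia. w ia z * f i z) \<le> (SUP n. w n z * f n z)"
      proof (intro SUP_least)
        fix a b
        \<comment> \<open>Both factors increase with the index, so the double supremum is attained
          along the diagonal.\<close>
        have "w b z * f a z \<le> w (max a b) z * f (max a b) z"
          by (intro mult_mono f_mono w_mono) auto
        then show "w b z * f a z \<le> (SUP n. w n z * f n z)" by (rule SUP_upper2[rotated]) auto
      qed
      show "(SUP n. w n z * f n z) \<le> (SUP i. SUP ia. w ia z * f i z)"
        by (intro SUP_least SUP_upper2[of _ UNIV] SUP_upper) auto
    qed
  qed
  also have "\<dots> = (SUP n. \<integral>\<^sup>+z. w n z * f n z \<partial>lborel)"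
    by (intro nn_integral_monotone_convergence_SUP)
       (auto simp: incseq_def le_fun_def intro!: mult_mono f_mono w_mono)
  finally show ?case
    unfolding conv_tail_jump_Suc f_def w_def by simp
qed

lemma conv_tail_jump_pos:
  assumes "0 < \<alpha>" "t < real j"
  shows "0 < conv_tail (jump_measure \<alpha> 0) j t"
  using assms(2)
proof (induction j arbitrary: t)
  case (Suc j)
  \<comment> \<open>A last jump larger than \<open>c\<close> must leave a level below
    \<open>j\<close> for the others. If t > j this requires t - j < c < 1, and the midpoint is
    taken.\<close>
  define c where "c = (if t - real j \<le> 0 then 1/2 else (t - real j + 1) / 2)"
  have c: "0 < c" "c < 1" "t - c < real j" using Suc.prems by (auto simp: c_def field_simps)
  let ?\<nu> = "jump_measure \<alpha> 0"
  have "conv_tail ?\<nu> j (t - c) * emeasure ?\<nu> {c<..1} = (\<integral>\<^sup>+z. conv_tail ?\<nu> j (t - c) * indicator {c<..1} z \<partial>?\<nu>)"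
    by (simp add: nn_integral_cmult_indicator)
  also have "\<dots> \<le> conv_tail ?\<nu> (Suc j) t"
    by (auto intro!: nn_integral_mono conv_tail_antimono split: split_indicator)
  finally have le: "conv_tail ?\<nu> j (t - c) * emeasure ?\<nu> {c<..1} \<le> conv_tail ?\<nu> (Suc j) t" .
  have "c powr -\<alpha> > 1" using c assms(1) powr_less_mono2_neg[of "-\<alpha>" c 1] by simp
  then have "emeasure ?\<nu> {c<..1} > 0"
    using emeasure_jump_measure[of 0 c 1 \<alpha>] c assms(1) by (simp add: ennreal_less_zero_iff)
  moreover have "conv_tail ?\<nu> j (t - c) > 0" using Suc.IH c(3) by auto
  ultimately show ?case using le by (metis ennreal_zero_less_mult_iff less_le_trans)
qed auto

text \<open>The recursion for c integrates over [s - k, 1] only; for smaller z the argument s - z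
  exceeds k and the tail of \<open>k\<close> jumps vanishes. Agreement on the half-open interval for
  \<open>k\<close> yields agreement on the closed one for \<open>k + 1\<close>, in particular at its
  left end s = k, the value in the theorem.\<close>

lemma conv_tail_jump_Suc_eq_c_fun:
  assumes "0 < \<alpha>" "1 \<le> k"
    and eq: "\<And>t. real k - 1 < t \<Longrightarrow> t \<le> real k \<Longrightarrow> conv_tail (jump_measure \<alpha> 0) k t = c_fun \<alpha> k t"
    and s: "real k \<le> s" "s \<le> real k + 1"
  shows "conv_tail (jump_measure \<alpha> 0) (Suc k) s = c_fun \<alpha> (Suc k) s"
proof -
  let ?\<nu> = "jump_measure \<alpha> 0"
  obtain m where m: "k = Suc m" using \<open>1 \<le> k\<close> by (cases k) auto
  define w where "w = (\<lambda>z. ennreal (z powr (-\<alpha> - 1)) * indicator {s - real k..1} z)"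
  have [measurable]: "w \<in> borel_measurable borel" unfolding w_def by measurable
  \<comment> \<open>For s = k the point z = 1 leads to the argument k - 1, where agreement is not
    assumed. It is a null set, and so is the endpoint z = 0.\<close>
  have AE: "AE z in lborel. z \<noteq> 0 \<and> z \<noteq> (1::real)"
    using AE_lborel_singleton[of 0] AE_lborel_singleton[of 1] by eventually_elim auto
  have eq': "conv_tail ?\<nu> k (s - z) * w z = c_fun \<alpha> k (s - z) * w z" if "z \<noteq> 0 \<and> z \<noteq> 1" for z
    using that s eq[of "s - z"] by (auto simp: w_def split: split_indicator)
  have "conv_tail ?\<nu> (Suc k) s = (\<integral>\<^sup>+z. ennreal \<alpha> * (conv_tail ?\<nu> k (s - z) * w z) \<partial>lborel)"
    unfolding conv_tail_jump_Suc
  proof (intro nn_integral_cong_AE, use AE in eventually_elim)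
    fix z :: real assume z: "z \<noteq> 0 \<and> z \<noteq> 1"
    show "ennreal (\<alpha> * z powr (-\<alpha> - 1)) * indicator {0<..1} z * conv_tail ?\<nu> k (s - z) =
       ennreal \<alpha> * (conv_tail ?\<nu> k (s - z) * w z)"
      using z s assms(1) conv_tail_jump_eq_0[of k "s - z" \<alpha> 0]
      by (auto simp: w_def ennreal_mult' mult_ac split: split_indicator)
  qed
  also have "\<dots> = ennreal \<alpha> * (\<integral>\<^sup>+z. conv_tail ?\<nu> k (s - z) * w z \<partial>lborel)"
    by (intro nn_integral_cmult) measurable
  also have "(\<integral>\<^sup>+z. conv_tail ?\<nu> k (s - z) * w z \<partial>lborel) = (\<integral>\<^sup>+z. c_fun \<alpha> k (s - z) * w z \<partial>lborel)"
    by (intro nn_integral_cong_AE eventually_mono[OF AE] eq')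
  finally show ?thesis by (simp add: m w_def mult_ac)
qed

lemma conv_tail_jump_eq_c_fun:
  assumes "0 < \<alpha>" "1 \<le> k"
  shows "real k - 1 < t \<Longrightarrow> t \<le> real k \<Longrightarrow> conv_tail (jump_measure \<alpha> 0) k t = c_fun \<alpha> k t"
  using \<open>1 \<le> k\<close>
proof (induction k arbitrary: t rule: nat_induct_at_least)
  case base
  have "conv_tail (jump_measure \<alpha> 0) (Suc 0) t = (\<integral>\<^sup>+z. indicator {t<..1} z \<partial>jump_measure \<alpha> 0)"
    unfolding conv_tail_jump_Suc
    by (subst nn_integral_jump_measure) (auto intro!: nn_integral_cong split: split_indicator)
  with base show ?case using emeasure_jump_measure[of 0 t 1 \<alpha>] assms(1) by simp
next
  case (Suc k)
  show ?case
    by (rule conv_tail_jump_Suc_eq_c_fun[OF assms(1) Suc.hyps Suc.IH]) (use Suc.prems in auto)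
qed

section \<open>Finiteness of c_{k+1}(k)\<close>

lemma nn_integral_powr_01_finite:
  assumes "a > -1"
  shows "(\<integral>\<^sup>+z. ennreal (z powr a) * indicator {0..1} z \<partial>lborel) < \<infinity>"
  using has_integral_powr_from_0[of a 1] assms
  by (subst nn_integral_has_integral_lebesgue'[where I = "1 / (a + 1)"]) auto

text \<open>
  If the last jump is \<open>z \<le> 1/2\<close>, the other \<open>k\<close> jumps exceed $1 - z \ge 1/2$, so the Lipschitz bound
  with \<open>\<epsilon> = 1/2\<close> shows that the integrand decays linearly in \<open>z\<close> and tames $z^{-\alpha-1}$.
\<close>

lemma conv_tail_jump_finite_step:
  assumes \<alpha>: "0 < \<alpha>" "\<alpha> < 1" and "k \<ge> 1"
    and fin: "(\<integral>\<^sup>+z. conv_tail (jump_measure \<alpha> 0) k (real k - z) * indicator {1/2..1} z \<partial>lborel) < \<infinity>"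
  shows "conv_tail (jump_measure \<alpha> 0) (Suc k) (real k) < \<infinity>"
proof -
  let ?\<nu> = "jump_measure \<alpha> 0"
  obtain m where m: "k = Suc m" using \<open>k \<ge> 1\<close> by (cases k) auto
  obtain C where C: "C \<ge> 0" "\<And>t h. h \<ge> 0 \<Longrightarrow> conv_tail (jump_measure \<alpha> (1/2)) k (t - h) \<le>
      conv_tail (jump_measure \<alpha> (1/2)) k t + ennreal (C * h)"
    unfolding m using conv_tail_jump_Lipschitz[OF \<alpha>(1), of "1/2" m] by auto
  have near: "conv_tail ?\<nu> k (real k - z) \<le> ennreal (C * z)" if "0 \<le> z" "z \<le> 1/2" for z
  proof -
    have "conv_tail ?\<nu> k (real k - z) = conv_tail (jump_measure \<alpha> (1/2)) k (real k - z)"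
      using that by (intro conv_tail_jump_eq[symmetric]) auto
    also have "\<dots> \<le> conv_tail (jump_measure \<alpha> (1/2)) k (real k) + ennreal (C * z)"
      using that by (intro C(2))
    finally show ?thesis by (simp add: conv_tail_jump_eq_0)
  qed
  define B where "B = \<alpha> * (1/2) powr (-\<alpha> - 1)"
  have "conv_tail ?\<nu> (Suc k) (real k) \<le>
    (\<integral>\<^sup>+z. ennreal (\<alpha> * C) * (ennreal (z powr -\<alpha>) * indicator {0..1} z) +
        ennreal B * (conv_tail ?\<nu> k (real k - z) * indicator {1/2..1} z) \<partial>lborel)"
    unfolding conv_tail_jump_Suc
  proof (intro nn_integral_mono)
    fix z :: real
    consider "z \<le> 0 \<or> z > 1" | "0 < z" "z \<le> 1/2" | "1/2 < z" "z \<le> 1" by linarith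
    then show "ennreal (\<alpha> * z powr (-\<alpha> - 1)) * indicator {0<..1} z * conv_tail ?\<nu> k (real k - z)
      \<le> ennreal (\<alpha> * C) * (ennreal (z powr -\<alpha>) * indicator {0..1} z) +
        ennreal B * (conv_tail ?\<nu> k (real k - z) * indicator {1/2..1} z)"
    proof cases
      case 2
      have "ennreal (\<alpha> * z powr (-\<alpha> - 1)) * conv_tail ?\<nu> k (real k - z) \<le>
        ennreal (\<alpha> * z powr (-\<alpha> - 1)) * ennreal (C * z)"
        using 2 by (intro mult_left_mono near) auto
      also have "\<dots> = ennreal (\<alpha> * C) * ennreal (z powr -\<alpha>)"
        using 2 C(1) \<alpha> by (simp add: ennreal_mult[symmetric] powr_diff field_simps)
      also have "\<dots> \<le> ennreal (\<alpha> * C) * ennreal (z powr -\<alpha>) + ennreal B * (conv_tail ?\<nu> k (real k - z) * indicator {1/2..1} z)"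
        by (rule add_increasing2) auto
      finally show ?thesis using 2 by (simp del: conv_tail.simps)
    next
      case 3
      have "ennreal (\<alpha> * z powr (-\<alpha> - 1)) \<le> ennreal B"
        unfolding B_def using 3 \<alpha> by (intro ennreal_leI mult_left_mono powr_mono2') auto
      then have "ennreal (\<alpha> * z powr (-\<alpha> - 1)) * conv_tail ?\<nu> k (real k - z) \<le> ennreal B * conv_tail ?\<nu> k (real k - z)"
        by (rule mult_right_mono) auto
      also have "\<dots> \<le> ennreal (\<alpha> * C) * ennreal (z powr -\<alpha>) + ennreal B * conv_tail ?\<nu> k (real k - z)"
        by (rule add_increasing) auto
      finally show ?thesis using 3 by (simp del: conv_tail.simps)
    qed auto
  qed
  also have "\<dots> = ennreal (\<alpha> * C) * (\<integral>\<^sup>+z. ennreal (z powr -\<alpha>) * indicator {0..1} z \<partial>lborel) +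
      ennreal B * (\<integral>\<^sup>+z. conv_tail ?\<nu> k (real k - z) * indicator {1/2..1} z \<partial>lborel)"
    by (subst nn_integral_add) (measurable, simp add: nn_integral_cmult)
  also have "\<dots> < \<infinity>"
    using nn_integral_powr_01_finite[of "-\<alpha>"] fin \<alpha> by (auto simp: ennreal_mult_less_top)
  finally show ?thesis .
qed

text \<open>What remains is the range z \<ge> 1/2 of the last jump. For k = 1 the integrand there is
  at most (1 - z)^(-\<alpha>), integrable because \<alpha> < 1. In the induction step the argument k
  + 1 - z is at least k, so the tail is bounded by its value at k, finite by the induction
  hypothesis.\<close>

lemma conv_tail_jump_finite_at_pred:
  assumes \<alpha>: "0 < \<alpha>" "\<alpha> < 1" and "k \<ge> 1"
  shows "conv_tail (jump_measure \<alpha> 0) (Suc k) (real k) < \<infinity>"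
  using \<open>k \<ge> 1\<close>
proof (induction k rule: nat_induct_at_least)
  case base
  have le: "conv_tail (jump_measure \<alpha> 0) 1 (real 1 - z) * indicator {1/2..1} z \<le> ennreal ((1 - z) powr -\<alpha>) * indicator {0..1} (1 - z)"
    if "z \<noteq> 1" for z
  proof (cases "1/2 \<le> z \<and> z \<le> 1")
    case True
    then have "conv_tail (jump_measure \<alpha> 0) 1 (real 1 - z) = c_fun \<alpha> 1 (real 1 - z)"
      using that \<alpha> by (intro conv_tail_jump_eq_c_fun) simp_all
    also have "\<dots> \<le> ennreal ((1 - z) powr -\<alpha>)"
      using that by (simp add: ennreal_leI)
    finally show ?thesis using True by (simp del: conv_tail.simps One_nat_def)
  qed simp
  have "(\<integral>\<^sup>+z. conv_tail (jump_measure \<alpha> 0) 1 (real 1 - z) * indicator {1/2..1} z \<partial>lborel) \<le>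
      (\<integral>\<^sup>+z. ennreal ((1 - z) powr -\<alpha>) * indicator {0..1} (1 - z) \<partial>lborel)"
    by (intro nn_integral_mono_AE eventually_mono[OF AE_lborel_singleton[of 1]] le)
  also have "\<dots> = (\<integral>\<^sup>+z. ennreal (z powr -\<alpha>) * indicator {0..1} z \<partial>lborel)"
    using nn_integral_real_affine[of "\<lambda>z. ennreal (z powr -\<alpha>) * indicator {0..1} z" "-1" 1] by simp
  also have "\<dots> < \<infinity>" using nn_integral_powr_01_finite[of "-\<alpha>"] \<alpha> by simp
  finally show ?case by (rule conv_tail_jump_finite_step[OF \<alpha>, rotated]) simp
next
  case (Suc k)
  have "(\<integral>\<^sup>+z. conv_tail (jump_measure \<alpha> 0) (Suc k) (real (Suc k) - z) * indicator {1/2..1} z \<partial>lborel) \<le>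
    (\<integral>\<^sup>+z. conv_tail (jump_measure \<alpha> 0) (Suc k) (real k) * indicator {1/2..1::real} z \<partial>lborel)"
  proof (intro nn_integral_mono)
    fix z :: real
    show "conv_tail (jump_measure \<alpha> 0) (Suc k) (real (Suc k) - z) * indicator {1/2..1} z \<le> conv_tail (jump_measure \<alpha> 0) (Suc k) (real k) * indicator {1/2..1::real} z"
      by (cases "z \<le> 1") (simp_all add: conv_tail_antimono mult_right_mono del: conv_tail.simps)
  qed
  also have "\<dots> = conv_tail (jump_measure \<alpha> 0) (Suc k) (real k) * emeasure lborel {1/2..1::real}"
    by (rule nn_integral_cmult_indicator) simp
  also have "emeasure lborel {1/2..1::real} = ennreal (1/2)" by (subst emeasure_lborel_Icc) auto
  also have "conv_tail (jump_measure \<alpha> 0) (Suc k) (real k) * ennreal (1/2) < \<infinity>"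
    using Suc.IH ennreal_less_top[of "1/2"] unfolding ennreal_mult_less_top infinity_ennreal_def by blast
  finally show ?case by (rule conv_tail_jump_finite_step[OF \<alpha>, rotated]) simp
qed

section \<open>Regularly varying tails\<close>

text \<open>Finitely many halvings bring any x \<ge> x0 into [x0, 2 x0]. Both consequences of
  regular variation below use only the limit for the factor 1/2 and this induction.\<close>

lemma halving_induct:
  fixes x0 :: real
  assumes "0 < x0" and base: "\<And>x. x0 \<le> x \<Longrightarrow> x \<le> 2 * x0 \<Longrightarrow> Q x"
    and step: "\<And>x. 2 * x0 \<le> x \<Longrightarrow> Q (x / 2) \<Longrightarrow> Q x"
    and "x0 \<le> x"
  shows "Q x"
proof -
  have *: "x0 \<le> x \<Longrightarrow> x \<le> 2 ^ n * x0 \<Longrightarrow> Q x" for n x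
  proof (induction n arbitrary: x)
    case 0
    then show ?case using \<open>0 < x0\<close> by (intro base) auto
  next
    case (Suc n)
    then show ?case
      using Suc.IH[of "x / 2"] base[of x] step[of x] by (cases "x \<le> 2 * x0") auto
  qed
  obtain n where "x / x0 < 2 ^ n" using real_arch_pow[of 2 "x / x0"] by auto
  then show ?thesis using *[of x n] \<open>0 < x0\<close> \<open>x0 \<le> x\<close> by (simp add: field_simps)
qed

text \<open>Here \<open>g\<close> stands for a truncated first moment, so the lemma serves both Y
  and |Y|. The ratio F(x/2) / F(x) tends to 2^\<alpha> < 2, so halving x shrinks x F(x) by a factor
  bounded away from 1, and the recursion for \<open>g\<close> closes.\<close>

lemma Karamata_upper_bound:
  fixes F g :: "real \<Rightarrow> real"
  assumes pos: "\<And>x. 0 < F x" and anti: "\<And>x y. x \<le> y \<Longrightarrow> F y \<le> F x"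
    and lim: "((\<lambda>x. F (1/2 * x) / F x) \<longlongrightarrow> (1/2) powr -\<alpha>) at_top" and "\<alpha> < 1"
    and g_le: "\<And>x. 0 \<le> x \<Longrightarrow> g x \<le> x" and g_half: "\<And>x. 0 < x \<Longrightarrow> g x \<le> g (x / 2) + x * F (x / 2)"
  shows "\<exists>K>0. \<forall>\<^sub>F x in at_top. g x \<le> K * (x * F x)"
proof -
  have "(1/2) powr -\<alpha> < (2::real)"
    using powr_less_mono[of \<alpha> 1 2] \<open>\<alpha> < 1\<close> by (simp add: powr_minus_divide powr_divide)
  then obtain l where l: "(1/2) powr -\<alpha> < l" "l < (2::real)" using dense by blast
  have "0 < l" using l(1) powr_gt_zero[of "1/2" "-\<alpha>"] by linarith
  have "\<forall>\<^sub>F x in at_top. F (1/2 * x) / F x < l"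
    using lim l(1) by (rule order_tendstoD)
  then obtain x1 where "\<forall>x\<ge>x1. F (x / 2) < l * F x"
    using pos by (auto simp: eventually_at_top_linorder field_simps)
  then have x1: "\<And>x. x \<ge> x1 \<Longrightarrow> F (x / 2) \<le> l * F x" by (simp add: less_imp_le)
  define x0 where "x0 = max x1 1"
  \<comment> \<open>The first entry covers the base interval, where g x \<le> x. The second is the
    solution of (K/2 + 1) l = K, so the inductive step reproduces K; it is positive because l <
    2.\<close>
  define K where "K = max (2 / F (2 * x0)) (l / (1 - l / 2))"
  have K: "2 / F (2 * x0) \<le> K" "l / (1 - l / 2) \<le> K" by (auto simp: K_def)
  have "0 < K" using K(1) pos[of "2 * x0"] by (smt (verit) divide_pos_pos)
  have "g x \<le> K * (x * F x)" if "x0 \<le> x" for x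
  proof (rule halving_induct[of x0 "\<lambda>x. g x \<le> K * (x * F x)", OF _ _ _ that])
    show "0 < x0" by (simp add: x0_def)
  next
    fix x assume x: "x0 \<le> x" "x \<le> 2 * x0"
    then have "0 < x" by (auto simp: x0_def)
    have "g x \<le> x" using g_le \<open>0 < x\<close> by simp
    also have "\<dots> \<le> (2 / F (2 * x0)) * (x * F x)"
    proof -
      have "x * F (2 * x0) \<le> 2 * (x * F x)"
        using anti[OF x(2)] \<open>0 < x\<close> pos[of "2 * x0"] by (smt (verit) mult_left_mono mult_pos_pos)
      then show ?thesis using pos[of "2 * x0"] by (simp add: field_simps)
    qed
    also have "\<dots> \<le> K * (x * F x)"
      using K(1) \<open>0 < x\<close> pos[of x] by (intro mult_right_mono) auto
    finally show "g x \<le> K * (x * F x)" .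
  next
    fix x assume x: "2 * x0 \<le> x" and IH: "g (x / 2) \<le> K * (x / 2 * F (x / 2))"
    have "0 < x" "x1 \<le> x" using x by (auto simp: x0_def)
    have "g x \<le> K * (x / 2 * F (x / 2)) + x * F (x / 2)"
      using g_half[OF \<open>0 < x\<close>] IH by simp
    also have "\<dots> = (K / 2 + 1) * x * F (x / 2)" by (simp add: field_simps)
    also have "\<dots> \<le> (K / 2 + 1) * x * (l * F x)"
      using x1[OF \<open>x1 \<le> x\<close>] \<open>0 < K\<close> \<open>0 < x\<close> by (intro mult_left_mono) auto
    also have "\<dots> = ((K / 2 + 1) * l) * (x * F x)" by simp
    also have "\<dots> \<le> K * (x * F x)"
      using K(2) l(2) \<open>0 < x\<close> pos[of x] by (intro mult_right_mono) (auto simp: field_simps)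
    finally show "g x \<le> K * (x * F x)" .
  qed
  then show ?thesis using \<open>0 < K\<close> by (auto simp: eventually_at_top_linorder)
qed

text \<open>Each doubling of x eventually divides F by at least 2^\<beta>, as its limiting factor is
  2^\<alpha>; this is the decay of x^(-\<beta>).\<close>

lemma Potter_upper_bound:
  fixes F :: "real \<Rightarrow> real"
  assumes pos: "\<And>x. 0 < F x" and le1: "\<And>x. F x \<le> 1"
    and lim: "((\<lambda>x. F (1/2 * x) / F x) \<longlongrightarrow> (1/2) powr -\<alpha>) at_top" and "0 < \<beta>" "\<beta> < \<alpha>"
  shows "\<exists>C>0. \<forall>\<^sub>F x in at_top. F x \<le> C * x powr -\<beta>"
proof -
  have "2 powr \<beta> < (1/2) powr -\<alpha>"
    using powr_less_mono[of \<beta> \<alpha> 2] \<open>\<beta> < \<alpha>\<close> by (simp add: powr_minus_divide powr_divide)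
  then have "\<forall>\<^sub>F x in at_top. 2 powr \<beta> < F (1/2 * x) / F x"
    by (intro order_tendstoD[OF lim])
  then obtain x1 where "\<forall>x\<ge>x1. 2 powr \<beta> * F x < F (x / 2)"
    using pos by (auto simp: eventually_at_top_linorder field_simps)
  then have x1: "\<And>x. x \<ge> x1 \<Longrightarrow> 2 powr \<beta> * F x \<le> F (x / 2)" by (simp add: less_imp_le)
  define x0 where "x0 = max x1 1"
  \<comment> \<open>On the base interval this makes the right-hand side at least 1, which dominates
    F.\<close>
  define C where "C = (2 * x0) powr \<beta>"
  have "F x \<le> C * x powr -\<beta>" if "x0 \<le> x" for x
  proof (rule halving_induct[of x0 "\<lambda>x. F x \<le> C * x powr -\<beta>", OF _ _ _ that])
    show "0 < x0" by (simp add: x0_def)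
  next
    fix x assume x: "x0 \<le> x" "x \<le> 2 * x0"
    then have "0 < x" by (auto simp: x0_def)
    have "x powr \<beta> \<le> C" unfolding C_def using x \<open>0 < x\<close> \<open>0 < \<beta>\<close> by (intro powr_mono2) auto
    then have "1 \<le> C * x powr -\<beta>" using \<open>0 < x\<close> by (simp add: powr_minus field_simps)
    then show "F x \<le> C * x powr -\<beta>" using le1[of x] by linarith
  next
    fix x assume x: "2 * x0 \<le> x" and IH: "F (x / 2) \<le> C * (x / 2) powr -\<beta>"
    have "0 < x" "x1 \<le> x" using x by (auto simp: x0_def)
    have "2 powr \<beta> * F x \<le> C * (x / 2) powr -\<beta>" using x1[OF \<open>x1 \<le> x\<close>] IH by linarith
    also have "\<dots> = 2 powr \<beta> * (C * x powr -\<beta>)"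
      using \<open>0 < x\<close> by (simp add: powr_divide powr_minus field_simps)
    finally show "F x \<le> C * x powr -\<beta>" by simp
  qed
  moreover have "0 < C" by (simp add: C_def x0_def)
  ultimately show ?thesis by (auto simp: eventually_at_top_linorder)
qed

section \<open>Independent identically distributed variables\<close>

locale iid_seq = prob_space P for P :: "'a measure" +
  fixes Y :: "nat \<Rightarrow> 'a \<Rightarrow> real"
  assumes indep: "indep_vars (\<lambda>_. borel) Y UNIV"
    and ident: "\<And>j. distr P borel (Y j) = distr P borel (Y 0)"
begin

lemma rv [measurable]: "Y j \<in> borel_measurable P"
  using indep by (auto simp: indep_vars_def)

lemma prob_ident:
  assumes "B \<in> sets borel"
  shows "\<P>(\<omega> in P. Y j \<omega> \<in> B) = \<P>(\<omega> in P. Y 0 \<omega> \<in> B)"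
proof -
  have "measure (distr P borel (Y j)) B = \<P>(\<omega> in P. Y j \<omega> \<in> B)" for j
    using assms by (subst measure_distr) (auto intro!: arg_cong[of _ _ prob])
  then show ?thesis by (metis ident)
qed

lemma nn_integral_ident:
  assumes [measurable]: "g \<in> borel_measurable borel"
  shows "(\<integral>\<^sup>+\<omega>. g (Y j \<omega>) \<partial>P) = (\<integral>\<^sup>+\<omega>. g (Y 0 \<omega>) \<partial>P)"
proof -
  have "(\<integral>\<^sup>+x. g x \<partial>distr P borel (Y j)) = (\<integral>\<^sup>+\<omega>. g (Y j \<omega>) \<partial>P)" for j
    by (rule nn_integral_distr) measurable
  then show ?thesis by (metis ident)
qed

lemma prob_all:
  assumes "finite I" "B \<in> sets borel"
  shows "\<P>(\<omega> in P. \<forall>i\<in>I. Y i \<omega> \<in> B) = \<P>(\<omega> in P. Y 0 \<omega> \<in> B) ^ card I"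
proof (cases "I = {}")
  case False
  have "{\<omega> \<in> space P. \<forall>i\<in>I. Y i \<omega> \<in> B} = (\<Inter>i\<in>I. Y i -` B \<inter> space P)" using False by auto
  moreover have "Y i -` B \<inter> space P = {\<omega> \<in> space P. Y i \<omega> \<in> B}" for i by auto
  ultimately have "\<P>(\<omega> in P. \<forall>i\<in>I. Y i \<omega> \<in> B) = (\<Prod>i\<in>I. \<P>(\<omega> in P. Y i \<omega> \<in> B))"
    using indep_varsD[OF indep False assms(1), of "\<lambda>_. B"] assms(2) by simp
  also have "\<dots> = (\<Prod>i\<in>I. \<P>(\<omega> in P. Y 0 \<omega> \<in> B))"
    by (intro prod.cong refl prob_ident assms)
  finally show ?thesis by simp
qed (simp add: prob_space)

text \<open>One shape of event, a condition on each coordinate together with one on a sum, covers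
  all uses; trivial conditions are given by \<open>UNIV\<close>.\<close>

lemma prob_indep_blocks:
  fixes f g :: "real \<Rightarrow> real"
  assumes "I \<inter> J = {}" "finite I" "finite J"
    and [measurable]: "f \<in> borel_measurable borel" "g \<in> borel_measurable borel"
      "A \<in> sets borel" "A' \<in> sets borel" "B \<in> sets borel" "B' \<in> sets borel"
  shows "\<P>(\<omega> in P. ((\<forall>i\<in>I. Y i \<omega> \<in> A) \<and> (\<Sum>i\<in>I. f (Y i \<omega>)) \<in> A') \<and> (\<forall>j\<in>J. Y j \<omega> \<in> B) \<and> (\<Sum>j\<in>J. g (Y j \<omega>)) \<in> B') =
    \<P>(\<omega> in P. (\<forall>i\<in>I. Y i \<omega> \<in> A) \<and> (\<Sum>i\<in>I. f (Y i \<omega>)) \<in> A') *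
    \<P>(\<omega> in P. (\<forall>j\<in>J. Y j \<omega> \<in> B) \<and> (\<Sum>j\<in>J. g (Y j \<omega>)) \<in> B')"
proof -
  let ?X = "\<lambda>I \<omega>. restrict (\<lambda>i. Y i \<omega>) I"
  define Q where "Q = (\<lambda>(I :: nat set) (f :: real \<Rightarrow> real) A A'. {v \<in> space (PiM I (\<lambda>_. borel)). (\<forall>i\<in>I. v i \<in> A) \<and> (\<Sum>i\<in>I. f (v i)) \<in> A'})"
  have Q: "Q I f A A' \<in> sets (PiM I (\<lambda>_. borel))"
    if [measurable]: "f \<in> borel_measurable borel" "A \<in> sets borel" "A' \<in> sets borel" and "finite I" for I :: "nat set" and f A A'
    unfolding Q_def using \<open>finite I\<close> by measurable
  have vim: "?X I -` Q I f A A' \<inter> space P = {\<omega> \<in> space P. (\<forall>i\<in>I. Y i \<omega> \<in> A) \<and> (\<Sum>i\<in>I. f (Y i \<omega>)) \<in> A'}" for I f A A'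
    by (auto simp: Q_def space_PiM)
  have "indep_var (PiM I (\<lambda>_. borel)) (?X I) (PiM J (\<lambda>_. borel)) (?X J)"
    using assms(1) by (intro indep_var_restrict[OF indep]) auto
  from indep_varD[OF this Q Q, of f A A' g B B'] assms
  have "prob ((\<lambda>\<omega>. (?X I \<omega>, ?X J \<omega>)) -` (Q I f A A' \<times> Q J g B B') \<inter> space P) =
     prob (?X I -` Q I f A A' \<inter> space P) * prob (?X J -` Q J g B B' \<inter> space P)" by simp
  also have "(\<lambda>\<omega>. (?X I \<omega>, ?X J \<omega>)) -` (Q I f A A' \<times> Q J g B B') \<inter> space P =
     (?X I -` Q I f A A' \<inter> space P) \<inter> (?X J -` Q J g B B' \<inter> space P)" by auto
  also have "\<dots> = {\<omega> \<in> space P. ((\<forall>i\<in>I. Y i \<omega> \<in> A) \<and> (\<Sum>i\<in>I. f (Y i \<omega>)) \<in> A') \<and> (\<forall>j\<in>J. Y j \<omega> \<in> B) \<and> (\<Sum>j\<in>J. g (Y j \<omega>)) \<in> B'}"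
    unfolding vim by auto
  finally show ?thesis unfolding vim .
qed

lemma nn_integral_sum_ident:
  assumes "finite J" and [measurable]: "g \<in> borel_measurable borel"
  shows "(\<integral>\<^sup>+\<omega>. (\<Sum>j\<in>J. g (Y j \<omega>)) \<partial>P) = of_nat (card J) * (\<integral>\<^sup>+\<omega>. g (Y 0 \<omega>) \<partial>P)"
proof -
  have "(\<integral>\<^sup>+\<omega>. (\<Sum>j\<in>J. g (Y j \<omega>)) \<partial>P) = (\<Sum>j\<in>J. \<integral>\<^sup>+\<omega>. g (Y j \<omega>) \<partial>P)"
    by (intro nn_integral_sum) measurable
  also have "\<dots> = (\<Sum>j\<in>J. \<integral>\<^sup>+\<omega>. g (Y 0 \<omega>) \<partial>P)"
    by (intro sum.cong refl nn_integral_ident assms)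
  finally show ?thesis by simp
qed

lemma prob_sum_Markov:
  assumes "finite J" and [measurable]: "g \<in> borel_measurable borel" and g: "\<And>x. 0 \<le> g x"
    and int: "integrable P (\<lambda>\<omega>. g (Y 0 \<omega>))" and "0 < c"
  shows "\<P>(\<omega> in P. (\<Sum>j\<in>J. g (Y j \<omega>)) \<ge> c) \<le> real (card J) * expectation (\<lambda>\<omega>. g (Y 0 \<omega>)) / c"
proof -
  have *: "(\<integral>\<^sup>+\<omega>. ennreal (\<Sum>j\<in>J. g (Y j \<omega>)) \<partial>P) = ennreal (real (card J) * expectation (\<lambda>\<omega>. g (Y 0 \<omega>)))"
    using nn_integral_sum_ident[of J "\<lambda>x. ennreal (g x)"] assms(1) g int
    by (simp add: nn_integral_eq_integral ennreal_mult ennreal_of_nat_eq_real_of_nat)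
  have E: "expectation (\<lambda>\<omega>. \<Sum>j\<in>J. g (Y j \<omega>)) = real (card J) * expectation (\<lambda>\<omega>. g (Y 0 \<omega>))"
    and "integrable P (\<lambda>\<omega>. \<Sum>j\<in>J. g (Y j \<omega>))"
    using nn_integral_eq_integrable[of "\<lambda>\<omega>. \<Sum>j\<in>J. g (Y j \<omega>)" P "real (card J) * expectation (\<lambda>\<omega>. g (Y 0 \<omega>))"] * g
    by (auto intro!: sum_nonneg mult_nonneg_nonneg)
  then show ?thesis
    using integral_Markov_inequality_measure[of P "\<lambda>\<omega>. \<Sum>j\<in>J. g (Y j \<omega>)" "space P" c] g \<open>0 < c\<close>
    by (auto simp: E sum_nonneg)
qed

text \<open>
  Markov's inequality for $(1 + 1/\rho)^{\sum_j g(Y_j)}$; by convexity each factor is at most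
  $1 + g(Y_j)/\rho$.
\<close>

lemma prob_sum_Chernoff:
  assumes "finite J" and [measurable]: "g \<in> borel_measurable borel" and g: "\<And>x. 0 \<le> g x" "\<And>x. g x \<le> 1"
    and \<rho>: "0 < \<rho>" "real (card J) * expectation (\<lambda>\<omega>. g (Y 0 \<omega>)) \<le> \<rho>"
  shows "\<P>(\<omega> in P. (\<Sum>j\<in>J. g (Y j \<omega>)) \<ge> real m) \<le> exp 1 * \<rho> ^ m"
proof -
  \<comment> \<open>With this choice a \<rho> = 1, so the exponential moment is at most exp 1, while
    (1 + a)^m is at least \<rho>^(-m).\<close>
  define a where "a = 1 / \<rho>"
  have a: "0 < a" using \<rho> by (simp add: a_def)
  define G where "G = (\<lambda>\<omega>. \<Prod>j\<in>J. 1 + a * g (Y j \<omega>))"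
  have G[measurable]: "G \<in> borel_measurable P" unfolding G_def by measurable
  have int: "integrable P (\<lambda>\<omega>. g (Y 0 \<omega>))"
    using g by (intro integrable_const_bound[of _ 1]) auto
  let ?e = "expectation (\<lambda>\<omega>. g (Y 0 \<omega>))"
  have e0: "0 \<le> ?e" by (intro Bochner_Integration.integral_nonneg g(1))
  have "(\<integral>\<^sup>+\<omega>. ennreal (G \<omega>) \<partial>P) = (\<Prod>j\<in>J. \<integral>\<^sup>+\<omega>. ennreal (1 + a * g (Y j \<omega>)) \<partial>P)"
  proof -
    have "ennreal (G \<omega>) = (\<Prod>j\<in>J. ennreal (1 + a * g (Y j \<omega>)))" for \<omega>
      unfolding G_def using a g by (subst prod_ennreal) auto
    moreover have "indep_vars (\<lambda>_. borel) (\<lambda>j \<omega>. ennreal (1 + a * g (Y j \<omega>))) J"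
      by (rule indep_vars_compose2[OF indep_vars_subset[OF indep]]) auto
    ultimately show ?thesis using indep_vars_nn_integral[OF assms(1)] by simp
  qed
  also have "\<dots> = (\<Prod>j\<in>J. ennreal (1 + a * ?e))"
  proof (rule prod.cong[OF refl])
    fix j
    have "(\<integral>\<^sup>+\<omega>. ennreal (1 + a * g (Y j \<omega>)) \<partial>P) = (\<integral>\<^sup>+\<omega>. ennreal (1 + a * g (Y 0 \<omega>)) \<partial>P)"
      by (rule nn_integral_ident) measurable
    also have "\<dots> = ennreal (1 + a * ?e)"
      using int a g by (subst nn_integral_eq_integral) (auto simp: prob_space)
    finally show "(\<integral>\<^sup>+\<omega>. ennreal (1 + a * g (Y j \<omega>)) \<partial>P) = ennreal (1 + a * ?e)" .
  qed
  also have "\<dots> = ennreal ((1 + a * ?e) ^ card J)"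
    unfolding prod_constant using a e0 by (intro ennreal_power) simp
  finally have nnG: "(\<integral>\<^sup>+\<omega>. ennreal (G \<omega>) \<partial>P) = ennreal ((1 + a * ?e) ^ card J)" .
  have G0: "0 \<le> G \<omega>" for \<omega> unfolding G_def using a g by (intro prod_nonneg) auto
  have "expectation G = (1 + a * ?e) ^ card J \<and> integrable P G"
    using nn_integral_eq_integrable[of G P "(1 + a * ?e) ^ card J"] nnG G0 a e0 by auto
  then have EG: "expectation G = (1 + a * ?e) ^ card J" and intG: "integrable P G" by auto
  have "(1 + a * ?e) ^ card J \<le> exp (a * ?e) ^ card J"
    using a e0 by (intro power_mono exp_ge_add_one_self) auto
  also have "\<dots> = exp (a * (real (card J) * ?e))" by (simp add: exp_of_nat_mult[symmetric] mult_ac)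
  also have "\<dots> \<le> exp (a * \<rho>)" using a \<rho> by simp
  also have "\<dots> = exp 1" using \<rho> by (simp add: a_def)
  finally have EG_le: "expectation G \<le> exp 1" by (simp add: EG)
  have G_ge: "(1 + a) ^ m \<le> G \<omega>" if "(\<Sum>j\<in>J. g (Y j \<omega>)) \<ge> real m" for \<omega>
  proof -
    have "(1 + a) ^ m = (1 + a) powr real m" using a by (simp add: powr_realpow)
    also have "\<dots> \<le> (1 + a) powr (\<Sum>j\<in>J. g (Y j \<omega>))" using a that by (intro powr_mono) auto
    also have "\<dots> = (\<Prod>j\<in>J. (1 + a) powr g (Y j \<omega>))" using a by (simp add: powr_sum)
    also have "\<dots> \<le> G \<omega>" unfolding G_def
    proof (intro prod_mono conjI)
      fix j
      let ?x = "g (Y j \<omega>)"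
      have "exp ((1 - ?x) *\<^sub>R 0 + ?x *\<^sub>R ln (1 + a)) \<le> (1 - ?x) * exp 0 + ?x * exp (ln (1 + a))"
        by (rule convex_onD[OF exp_convex]) (use g in auto)
      then show "(1 + a) powr ?x \<le> 1 + a * ?x" using a by (simp add: powr_def algebra_simps)
    qed auto
    finally show ?thesis .
  qed
  have "\<P>(\<omega> in P. (\<Sum>j\<in>J. g (Y j \<omega>)) \<ge> real m) \<le> \<P>(\<omega> in P. G \<omega> \<ge> (1 + a) ^ m)"
    using G_ge by (intro finite_measure_mono) auto
  also have "\<dots> \<le> expectation G / (1 + a) ^ m"
    using intG G0 a by (intro integral_Markov_inequality_measure[where A = "space P"]) auto
  also have "\<dots> \<le> exp 1 / (1 + a) ^ m" using EG_le a by (intro divide_right_mono) auto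
  also have "\<dots> \<le> exp 1 / a ^ m" using a by (intro divide_left_mono power_mono mult_pos_pos) auto
  also have "\<dots> = exp 1 * \<rho> ^ m" using \<rho> by (simp add: a_def power_divide)
  finally show ?thesis .
qed

text \<open>The window is random, with width the sum r over \<open>J\<close>. Conditioning on it is
  Fubini for the joint law of the two restricted families, a product law by independence. Since r /
  m \<le> 1 and \<open>I\<close> is nonempty, all but one of the factors r / m are dropped, and the
  integral of the remaining one is a first moment.\<close>

lemma prob_window_le:
  fixes g :: "real \<Rightarrow> real"
  assumes disj: "I \<inter> J = {}" "finite I" "finite J" "I \<noteq> {}" and [measurable]: "g \<in> borel_measurable borel" and g: "\<And>x. 0 \<le> g x"
    and int: "integrable P (\<lambda>\<omega>. g (Y 0 \<omega>))"
    and "0 < m" "u \<le> m" "0 \<le> c"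
    and window: "\<And>r. 0 \<le> r \<Longrightarrow> r \<le> u \<Longrightarrow> \<P>(\<omega> in P. Y 0 \<omega> \<in> {m - r<..m}) \<le> c * (r / m)"
  shows "\<P>(\<omega> in P. (\<forall>i\<in>I. m - (\<Sum>j\<in>J. g (Y j \<omega>)) < Y i \<omega> \<and> Y i \<omega> \<le> m) \<and> (\<Sum>j\<in>J. g (Y j \<omega>)) \<le> u)
     \<le> c ^ card I * (real (card J) * expectation (\<lambda>\<omega>. g (Y 0 \<omega>)) / m)"
proof -
  define X where "X = (\<lambda>I \<omega>. restrict (\<lambda>i. Y i \<omega>) I)"
  define r where "r = (\<lambda>w. \<Sum>j\<in>J. g (w j))"
  let ?S = "\<lambda>I. PiM I (\<lambda>_. borel) :: (nat \<Rightarrow> real) measure"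
  have [measurable]: "r \<in> borel_measurable (?S J)" unfolding r_def by measurable
  define Q where "Q = {x \<in> space (?S I \<Otimes>\<^sub>M ?S J). (\<forall>i\<in>I. m - r (snd x) < fst x i \<and> fst x i \<le> m) \<and> r (snd x) \<le> u}"
  have Q[measurable]: "Q \<in> sets (?S I \<Otimes>\<^sub>M ?S J)" unfolding Q_def using \<open>finite I\<close> by measurable
  have "indep_var (?S I) (X I) (?S J) (X J)"
    unfolding X_def using disj(1) by (intro indep_var_restrict[OF indep]) auto
  then have rvs[measurable]: "X I \<in> measurable P (?S I)" "X J \<in> measurable P (?S J)"
    and prod: "distr P (?S I) (X I) \<Otimes>\<^sub>M distr P (?S J) (X J) = distr P (?S I \<Otimes>\<^sub>M ?S J) (\<lambda>\<omega>. (X I \<omega>, X J \<omega>))"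
    by (auto simp: indep_var_distribution_eq)
  interpret S: prob_space "distr P (?S I) (X I)" by (rule prob_space_distr) measurable
  interpret R: prob_space "distr P (?S J) (X J)" by (rule prob_space_distr) measurable
  interpret SR: pair_prob_space "distr P (?S I) (X I)" "distr P (?S J) (X J)" ..
  have r0: "0 \<le> r w" for w unfolding r_def using g by (intro sum_nonneg) auto
  have rX: "r (X J \<omega>) = (\<Sum>j\<in>J. g (Y j \<omega>))" for \<omega> by (simp add: r_def X_def)
  have slice: "emeasure (distr P (?S I) (X I)) ((\<lambda>v. (v, w)) -` Q) \<le> ennreal (c ^ card I / m) * ennreal (r w)" for w
  proof (cases "r w \<le> u \<and> w \<in> space (?S J)")
    case True
    have sec: "(\<lambda>v. (v, w)) -` Q \<in> sets (?S I)" using Q by (rule sets_Pair2)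
    have "emeasure (distr P (?S I) (X I)) ((\<lambda>v. (v, w)) -` Q) = emeasure P (X I -` ((\<lambda>v. (v, w)) -` Q) \<inter> space P)"
      by (rule emeasure_distr) (use sec in measurable)
    also have "X I -` ((\<lambda>v. (v, w)) -` Q) \<inter> space P = {\<omega> \<in> space P. \<forall>i\<in>I. Y i \<omega> \<in> {m - r w<..m}}"
      using True by (auto simp: X_def Q_def space_pair_measure space_PiM)
    also have "emeasure P \<dots> = ennreal (\<P>(\<omega> in P. Y 0 \<omega> \<in> {m - r w<..m}) ^ card I)"
      using prob_all[OF \<open>finite I\<close>, of "{m - r w<..m}"] by (simp add: emeasure_eq_measure)
    also have "\<dots> \<le> ennreal (c ^ card I / m * r w)"
    proof (rule ennreal_leI)
      have rm: "0 \<le> r w / m" "r w / m \<le> 1" using True r0[of w] \<open>0 < m\<close> \<open>u \<le> m\<close> by (auto simp: field_simps)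
      have "card I \<ge> 1" using disj by (simp add: Suc_leI card_gt_0_iff)
      have "\<P>(\<omega> in P. Y 0 \<omega> \<in> {m - r w<..m}) ^ card I \<le> (c * (r w / m)) ^ card I"
        using window r0[of w] True by (intro power_mono) auto
      also have "\<dots> = c ^ card I * (r w / m) ^ card I" by (rule power_mult_distrib)
      also have "\<dots> \<le> c ^ card I * (r w / m) ^ 1"
        using rm \<open>card I \<ge> 1\<close> \<open>0 \<le> c\<close> by (intro mult_left_mono power_decreasing) auto
      finally show "\<P>(\<omega> in P. Y 0 \<omega> \<in> {m - r w<..m}) ^ card I \<le> c ^ card I / m * r w" by simp
    qed
    also have "\<dots> = ennreal (c ^ card I / m) * ennreal (r w)"
      using r0[of w] \<open>0 < m\<close> \<open>0 \<le> c\<close> by (intro ennreal_mult) auto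
    finally show ?thesis .
  next
    case False
    then have "(\<lambda>v. (v, w)) -` Q = {}" by (auto simp: Q_def space_pair_measure)
    then show ?thesis by simp
  qed
  have "{\<omega> \<in> space P. (\<forall>i\<in>I. m - r (X J \<omega>) < Y i \<omega> \<and> Y i \<omega> \<le> m) \<and> r (X J \<omega>) \<le> u} = (\<lambda>\<omega>. (X I \<omega>, X J \<omega>)) -` Q \<inter> space P"
    by (auto simp: Q_def X_def space_pair_measure space_PiM)
  then have "emeasure P {\<omega> \<in> space P. (\<forall>i\<in>I. m - r (X J \<omega>) < Y i \<omega> \<and> Y i \<omega> \<le> m) \<and> r (X J \<omega>) \<le> u} =
     emeasure (distr P (?S I) (X I) \<Otimes>\<^sub>M distr P (?S J) (X J)) Q"
    unfolding prod by (subst emeasure_distr) auto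
  also have "\<dots> = (\<integral>\<^sup>+w. emeasure (distr P (?S I) (X I)) ((\<lambda>v. (v, w)) -` Q) \<partial>distr P (?S J) (X J))"
    by (rule SR.emeasure_pair_measure_alt2) (simp add: Q cong: sets_pair_measure_cong)
  also have "\<dots> \<le> (\<integral>\<^sup>+w. ennreal (c ^ card I / m) * ennreal (r w) \<partial>distr P (?S J) (X J))"
    by (intro nn_integral_mono slice)
  also have "\<dots> = ennreal (c ^ card I / m) * (\<integral>\<^sup>+\<omega>. ennreal (r (X J \<omega>)) \<partial>P)"
    by (simp add: nn_integral_cmult nn_integral_distr)
  also have "(\<integral>\<^sup>+\<omega>. ennreal (r (X J \<omega>)) \<partial>P) = ennreal (real (card J) * expectation (\<lambda>\<omega>. g (Y 0 \<omega>)))"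
    unfolding rX using nn_integral_sum_ident[of J "\<lambda>x. ennreal (g x)"] disj g int
    by (simp add: nn_integral_eq_integral ennreal_mult ennreal_of_nat_eq_real_of_nat)
  also have "ennreal (c ^ card I / m) * \<dots> = ennreal (c ^ card I * (real (card J) * expectation (\<lambda>\<omega>. g (Y 0 \<omega>)) / m))"
    using \<open>0 < m\<close> \<open>0 \<le> c\<close> g by (subst ennreal_mult[symmetric]) auto
  finally show ?thesis
    using \<open>0 < m\<close> \<open>0 \<le> c\<close> g unfolding rX emeasure_eq_measure
    by (subst (asm) ennreal_le_iff) auto
qed

end

section \<open>Convergence of rescaled big summands\<close>

lemma cell_exists:
  fixes g :: "nat \<Rightarrow> real"
  shows "g 0 < x \<Longrightarrow> x \<le> g N \<Longrightarrow> \<exists>l<N. x \<in> {g l<..g (Suc l)}"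
proof (induction N)
  case (Suc N)
  show ?case
  proof (cases "x \<le> g N")
    case True
    then show ?thesis using Suc.IH[OF Suc.prems(1)] less_SucI by blast
  next
    case False
    then show ?thesis using Suc.prems(2) by (intro exI[of _ N]) simp
  qed
qed auto

lemma cell_unique:
  fixes g :: "nat \<Rightarrow> real"
  assumes "mono g" "x \<in> {g k<..g (Suc k)}" "x \<in> {g l<..g (Suc l)}"
  shows "k = l"
proof (rule ccontr)
  assume "k \<noteq> l"
  then consider "Suc k \<le> l" | "Suc l \<le> k" by linarith
  then show False
    using monoD[OF \<open>mono g\<close>, of "Suc k" l] monoD[OF \<open>mono g\<close>, of "Suc l" k] assms(2,3) by cases auto
qed

lemma sum_cell:
  fixes g :: "nat \<Rightarrow> real" and c :: "nat \<Rightarrow> ennreal"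
  assumes "mono g" "k < N" "x \<in> {g k<..g (Suc k)}"
  shows "(\<Sum>l<N. c l * indicator {g l<..g (Suc l)} x) = c k"
proof -
  have "c l * indicator {g l<..g (Suc l)} x = (if l = k then c k else 0)" for l
  proof (cases "l = k")
    case False
    then have "x \<notin> {g l<..g (Suc l)}" using cell_unique[OF assms(1,3)] by blast
    then show ?thesis using False by (simp only: indicator_simps) simp
  qed (use assms(3) in simp)
  then have "(\<Sum>l<N. c l * indicator {g l<..g (Suc l)} x) = (\<Sum>l<N. if l = k then c k else 0)"
    by (rule sum.cong[OF refl])
  then show ?thesis using assms(2) by simp
qed

text \<open>The weights are the \<open>jump_measure\<close> masses of the grid cells, so the sums
  are integrals of step functions. On a cell, replacing z by an endpoint moves the argument by at
  most the mesh \<open>h\<close>; monotonicity turns this into the shift by \<open>h\<close>. The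
  two sums are the limits of the bounds for window probabilities obtained by cutting one summand
  into cells.\<close>

lemma grid_sum_le_conv_tail:
  assumes \<alpha>: "0 < \<alpha>" and \<epsilon>: "0 < \<epsilon>" "\<epsilon> \<le> 1" and g: "mono g" "g 0 = \<epsilon>" "g N = 1" "\<And>l. g (Suc l) \<le> g l + h"
  shows "(\<Sum>l<N. (g l powr -\<alpha> - g (Suc l) powr -\<alpha>) * enn2real (conv_tail (jump_measure \<alpha> \<epsilon>) j (s - g (Suc l))))
     \<le> enn2real (conv_tail (jump_measure \<alpha> \<epsilon>) (Suc j) (s - h))" (is ?A)
    and "enn2real (conv_tail (jump_measure \<alpha> \<epsilon>) (Suc j) (s + h)) \<le>
     (\<Sum>l<N. (g l powr -\<alpha> - g (Suc l) powr -\<alpha>) * enn2real (conv_tail (jump_measure \<alpha> \<epsilon>) j (s - g l)))" (is ?B)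
proof -
  define \<nu> where "\<nu> = jump_measure \<alpha> \<epsilon>"
  define v where "v = (\<lambda>l. g l powr -\<alpha> - g (Suc l) powr -\<alpha>)"
  have gl: "\<epsilon> \<le> g l" "g l \<le> g (Suc l)" for l using monoD[OF g(1), of 0 l] monoD[OF g(1), of l "Suc l"] g(2) by auto
  have g1: "g (Suc l) \<le> 1" if "l < N" for l using monoD[OF g(1), of "Suc l" N] g(3) that by auto
  have [measurable_cong]: "sets \<nu> = sets borel" by (simp add: \<nu>_def)
  have v: "emeasure \<nu> {g l<..g (Suc l)} = ennreal (v l)" "0 \<le> v l" if "l < N" for l
  proof -
    show "emeasure \<nu> {g l<..g (Suc l)} = ennreal (v l)"
      unfolding \<nu>_def v_def using gl[of l] g1[OF that] \<alpha> \<epsilon> by (intro emeasure_jump_measure) auto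
    show "0 \<le> v l" unfolding v_def using gl[of l] \<alpha> \<epsilon> powr_mono2'[of "-\<alpha>" "g l" "g (Suc l)"] by auto
  qed
  have fin: "conv_tail \<nu> i r = ennreal (enn2real (conv_tail \<nu> i r))" for i r
    using conv_tail_jump_finite[OF \<alpha> \<epsilon>, of i r] by (simp add: \<nu>_def)
  have int: "(\<integral>\<^sup>+z. (\<Sum>l<N. conv_tail \<nu> j (r l) * indicator {g l<..g (Suc l)} z) \<partial>\<nu>) =
     ennreal (\<Sum>l<N. v l * enn2real (conv_tail \<nu> j (r l)))" for r
  proof -
    have "(\<integral>\<^sup>+z. (\<Sum>l<N. conv_tail \<nu> j (r l) * indicator {g l<..g (Suc l)} z) \<partial>\<nu>) =
      (\<Sum>l<N. \<integral>\<^sup>+z. conv_tail \<nu> j (r l) * indicator {g l<..g (Suc l)} z \<partial>\<nu>)"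
      by (intro nn_integral_sum) measurable
    also have "\<dots> = (\<Sum>l<N. conv_tail \<nu> j (r l) * emeasure \<nu> {g l<..g (Suc l)})"
      by (intro sum.cong refl nn_integral_cmult_indicator) measurable
    also have "\<dots> = (\<Sum>l<N. ennreal (v l * enn2real (conv_tail \<nu> j (r l))))"
    proof (intro sum.cong refl)
      fix l assume "l \<in> {..<N}"
      then have "l < N" by simp
      show "conv_tail \<nu> j (r l) * emeasure \<nu> {g l<..g (Suc l)} = ennreal (v l * enn2real (conv_tail \<nu> j (r l)))"
        unfolding v(1)[OF \<open>l < N\<close>] using v(2)[OF \<open>l < N\<close>]
        by (subst fin) (simp only: ennreal_mult enn2real_nonneg mult.commute)
    qed
    also have "\<dots> = ennreal (\<Sum>l<N. v l * enn2real (conv_tail \<nu> j (r l)))"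
      using v(2) by (intro sum_ennreal) auto
    finally show ?thesis .
  qed
  have nn: "0 \<le> (\<Sum>l<N. v l * enn2real (conv_tail \<nu> j (r l)))" for r
    using v(2) by (intro sum_nonneg) auto
  have "ennreal (\<Sum>l<N. v l * enn2real (conv_tail \<nu> j (s - g (Suc l)))) \<le> conv_tail \<nu> (Suc j) (s - h)"
    unfolding int[symmetric] conv_tail.simps(2)
  proof (intro nn_integral_mono)
    fix z
    show "(\<Sum>l<N. conv_tail \<nu> j (s - g (Suc l)) * indicator {g l<..g (Suc l)} z) \<le> conv_tail \<nu> j (s - h - z)"
    proof (cases "\<exists>k<N. z \<in> {g k<..g (Suc k)}")
      case True
      then obtain k where k: "k < N" "z \<in> {g k<..g (Suc k)}" by blast
      show ?thesis unfolding sum_cell[OF g(1) k] using k g(4)[of k] by (intro conv_tail_antimono) auto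
    next
      case False
      then have "(\<Sum>l<N. conv_tail \<nu> j (s - g (Suc l)) * indicator {g l<..g (Suc l)} z) = 0"
        by (intro sum.neutral) auto
      then show ?thesis by simp
    qed
  qed
  then have "ennreal (\<Sum>l<N. v l * enn2real (conv_tail \<nu> j (s - g (Suc l)))) \<le> ennreal (enn2real (conv_tail \<nu> (Suc j) (s - h)))"
    by (simp only: fin[symmetric])
  then show ?A unfolding v_def \<nu>_def by (simp only: ennreal_le_iff[OF enn2real_nonneg])
  \<comment> \<open>For the upper estimate every z must lie in some cell, and the cells cover only
    (\<epsilon>,1].\<close>
  have AE: "AE z in \<nu>. \<epsilon> < z \<and> z \<le> 1"
    unfolding \<nu>_def jump_measure_def by (subst AE_density) (auto split: split_indicator)
  have "conv_tail \<nu> (Suc j) (s + h) \<le> ennreal (\<Sum>l<N. v l * enn2real (conv_tail \<nu> j (s - g l)))"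
    unfolding int[symmetric] conv_tail.simps(2)
  proof (intro nn_integral_mono_AE eventually_mono[OF AE])
    fix z assume "\<epsilon> < z \<and> z \<le> 1"
    then obtain k where k: "k < N" "z \<in> {g k<..g (Suc k)}" using cell_exists[of g z N] g(2,3) by auto
    show "conv_tail \<nu> j (s + h - z) \<le> (\<Sum>l<N. conv_tail \<nu> j (s - g l) * indicator {g l<..g (Suc l)} z)"
      unfolding sum_cell[OF g(1) k] using k g(4)[of k] by (intro conv_tail_antimono) auto
  qed
  then have "ennreal (enn2real (conv_tail \<nu> (Suc j) (s + h))) \<le> ennreal (\<Sum>l<N. v l * enn2real (conv_tail \<nu> j (s - g l)))"
    by (simp only: fin[symmetric])
  then have "enn2real (conv_tail \<nu> (Suc j) (s + h)) \<le> (\<Sum>l<N. v l * enn2real (conv_tail \<nu> j (s - g l)))"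
    by (simp only: ennreal_le_iff[OF nn])
  then show ?B unfolding v_def \<nu>_def .
qed

context iid_seq
begin

section \<open>Window probabilities of big summands\<close>

definition tail :: "real \<Rightarrow> real" where
  "tail x = \<P>(\<omega> in P. x < Y 0 \<omega>)"

lemma tail_antimono: "x \<le> y \<Longrightarrow> tail y \<le> tail x"
  unfolding tail_def by (intro finite_measure_mono) auto

lemma tail_nonneg: "0 \<le> tail x" and tail_le_1: "tail x \<le> 1"
  by (auto simp: tail_def)

lemma prob_Ioc:
  assumes "a \<le> b"
  shows "\<P>(\<omega> in P. Y j \<omega> \<in> {a<..b}) = tail a - tail b"
proof -
  have "\<P>(\<omega> in P. Y j \<omega> \<in> {a<..b}) = \<P>(\<omega> in P. Y 0 \<omega> \<in> {a<..b})" by (rule prob_ident) simp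
  also have "\<dots> = prob ({\<omega>\<in>space P. a < Y 0 \<omega>} - {\<omega>\<in>space P. b < Y 0 \<omega>})"
    by (intro arg_cong[of _ _ prob]) auto
  also have "\<dots> = tail a - tail b"
    unfolding tail_def using assms by (intro finite_measure_Diff) auto
  finally show ?thesis .
qed

text \<open>Divided by \<open>tail m ^ card I\<close> this is the counterpart, before the limit, of
  \<open>conv_tail (jump_measure \<alpha> \<epsilon>) (card I) t\<close>.\<close>

definition window_prob :: "real \<Rightarrow> real \<Rightarrow> real \<Rightarrow> nat set \<Rightarrow> real" where
  "window_prob \<epsilon> m t I = \<P>(\<omega> in P. (\<forall>i\<in>I. Y i \<omega> \<in> {\<epsilon> * m<..m}) \<and> (\<Sum>i\<in>I. Y i \<omega>) \<in> {t * m<..})"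

lemma prob_cell_window:
  assumes "finite I" "i \<notin> I" "a \<le> b"
  shows "\<P>(\<omega> in P. Y i \<omega> \<in> {a<..b} \<and> (\<forall>i\<in>I. Y i \<omega> \<in> {\<epsilon> * m<..m}) \<and> (\<Sum>i\<in>I. Y i \<omega>) \<in> {t * m<..}) =
    (tail a - tail b) * window_prob \<epsilon> m t I"
  using prob_indep_blocks[of "{i}" I "\<lambda>x. x" "\<lambda>x. x" "{a<..b}" UNIV "{\<epsilon> * m<..m}" "{t * m<..}"] assms
    prob_Ioc[OF assms(3), of i]
  unfolding window_prob_def by simp

text \<open>If the new summand lies in a cell, it is at most the right end of the cell, so the
  others must exceed the level reduced by that end. The union bound over the cells gives the
  sum.\<close>

lemma window_prob_insert_le:
  assumes I: "finite I" "i \<notin> I" and g: "mono g" "g 0 = \<epsilon>" "g N = 1" and "0 < m"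
  shows "window_prob \<epsilon> m t (insert i I) \<le> (\<Sum>l<N. (tail (g l * m) - tail (g (Suc l) * m)) * window_prob \<epsilon> m (t - g (Suc l)) I)"
proof -
  define E where "E = (\<lambda>l. {\<omega> \<in> space P. Y i \<omega> \<in> {g l * m<..g (Suc l) * m} \<and> (\<forall>i\<in>I. Y i \<omega> \<in> {\<epsilon> * m<..m}) \<and> (\<Sum>i\<in>I. Y i \<omega>) \<in> {(t - g (Suc l)) * m<..}})"
  have E[measurable]: "E l \<in> sets P" for l unfolding E_def using I by measurable
  have "window_prob \<epsilon> m t (insert i I) \<le> prob (\<Union>l<N. E l)"
    unfolding window_prob_def
  proof (intro finite_measure_mono)
    show "{\<omega> \<in> space P. (\<forall>i\<in>insert i I. Y i \<omega> \<in> {\<epsilon> * m<..m}) \<and> (\<Sum>i\<in>insert i I. Y i \<omega>) \<in> {t * m<..}} \<subseteq> (\<Union>l<N. E l)"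
    proof
      fix \<omega> assume \<omega>: "\<omega> \<in> {\<omega> \<in> space P. (\<forall>i\<in>insert i I. Y i \<omega> \<in> {\<epsilon> * m<..m}) \<and> (\<Sum>i\<in>insert i I. Y i \<omega>) \<in> {t * m<..}}"
      then have "g 0 * m < Y i \<omega>" "Y i \<omega> \<le> g N * m" using g by auto
      then obtain l where "l < N" "Y i \<omega> \<in> {g l * m<..g (Suc l) * m}"
        using cell_exists[of "\<lambda>l. g l * m" "Y i \<omega>" N] by auto
      then show "\<omega> \<in> (\<Union>l<N. E l)" using \<omega> I unfolding E_def by (auto simp: algebra_simps intro!: bexI[of _ l])
    qed
  qed measurable
  also have "\<dots> \<le> (\<Sum>l<N. prob (E l))" by (intro finite_measure_subadditive_finite) auto
  also have "\<dots> = (\<Sum>l<N. (tail (g l * m) - tail (g (Suc l) * m)) * window_prob \<epsilon> m (t - g (Suc l)) I)"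
    unfolding E_def using I \<open>0 < m\<close> monoD[OF g(1)]
    by (intro sum.cong refl prob_cell_window) (auto intro!: mult_right_mono)
  finally show ?thesis .
qed

text \<open>The new summand exceeds the left end of its cell, so it suffices that the others exceed
  the level reduced by that end. The cells are disjoint, hence the probabilities add.\<close>

lemma window_prob_insert_ge:
  assumes I: "finite I" "i \<notin> I" and g: "mono g" "g 0 = \<epsilon>" "g N = 1" and "0 < m"
  shows "window_prob \<epsilon> m t (insert i I) \<ge> (\<Sum>l<N. (tail (g l * m) - tail (g (Suc l) * m)) * window_prob \<epsilon> m (t - g l) I)"
proof -
  define E where "E = (\<lambda>l. {\<omega> \<in> space P. Y i \<omega> \<in> {g l * m<..g (Suc l) * m} \<and> (\<forall>i\<in>I. Y i \<omega> \<in> {\<epsilon> * m<..m}) \<and> (\<Sum>i\<in>I. Y i \<omega>) \<in> {(t - g l) * m<..}})"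
  have E[measurable]: "E l \<in> sets P" for l unfolding E_def using I by measurable
  have "(\<Sum>l<N. (tail (g l * m) - tail (g (Suc l) * m)) * window_prob \<epsilon> m (t - g l) I) = (\<Sum>l<N. prob (E l))"
    unfolding E_def using I \<open>0 < m\<close> monoD[OF g(1)]
    by (intro sum.cong refl prob_cell_window[symmetric]) (auto intro!: mult_right_mono)
  also have "\<dots> = prob (\<Union>l<N. E l)"
  proof (intro finite_measure_finite_Union[symmetric])
    have "mono (\<lambda>l. g l * m)" using monoD[OF g(1)] \<open>0 < m\<close> by (auto intro!: monoI mult_right_mono)
    then show "disjoint_family_on E {..<N}"
      unfolding disjoint_family_on_def E_def by (auto dest: cell_unique)
  qed auto
  also have "\<dots> \<le> window_prob \<epsilon> m t (insert i I)"
    unfolding window_prob_def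
  proof (intro finite_measure_mono)
    show "(\<Union>l<N. E l) \<subseteq> {\<omega> \<in> space P. (\<forall>i\<in>insert i I. Y i \<omega> \<in> {\<epsilon> * m<..m}) \<and> (\<Sum>i\<in>insert i I. Y i \<omega>) \<in> {t * m<..}}"
    proof
      fix \<omega> assume "\<omega> \<in> (\<Union>l<N. E l)"
      then obtain l where l: "l < N" "\<omega> \<in> E l" by auto
      have "\<epsilon> * m \<le> g l * m" "g (Suc l) * m \<le> 1 * m"
        using monoD[OF g(1), of 0 l] monoD[OF g(1), of "Suc l" N] g l \<open>0 < m\<close> by (auto intro!: mult_right_mono)
      with l show "\<omega> \<in> {\<omega> \<in> space P. (\<forall>i\<in>insert i I. Y i \<omega> \<in> {\<epsilon> * m<..m}) \<and> (\<Sum>i\<in>insert i I. Y i \<omega>) \<in> {t * m<..}}"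
        using I unfolding E_def by (auto simp: algebra_simps)
    qed
  qed (use I in measurable)
  finally show ?thesis .
qed

context
  fixes M :: "nat \<Rightarrow> real" and \<alpha> \<epsilon> :: real
  assumes M_pos: "\<forall>\<^sub>F n in sequentially. 0 < M n"
    and tail_pos: "\<And>x. 0 < tail x"
    and tail_lim: "\<And>s. 0 < s \<Longrightarrow> (\<lambda>n. tail (s * M n) / tail (M n)) \<longlonglongrightarrow> s powr -\<alpha>"
    and \<alpha>: "0 < \<alpha>" and \<epsilon>: "0 < \<epsilon>" "\<epsilon> \<le> 1"
begin

abbreviation (input) "d j t \<equiv> enn2real (conv_tail (jump_measure \<alpha> \<epsilon>) j t)"

text \<open>
  The shifts by \<open>\<delta>\<close> in the argument make up for the discontinuity of the limit at \<open>j = 0\<close> and absorb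
  the mesh of the grid in the induction step.
\<close>

lemma window_prob_bounds_ev:
  assumes "0 < \<delta>"
  shows "\<forall>\<^sub>F n in sequentially. \<forall>I. finite I \<longrightarrow> card I = j \<longrightarrow>
      window_prob \<epsilon> (M n) t I \<le> (d j (t - \<delta>) + \<delta>) * tail (M n) ^ j \<and>
      (d j (t + \<delta>) - \<delta>) * tail (M n) ^ j \<le> window_prob \<epsilon> (M n) t I"
  using assms
proof (induction j arbitrary: t \<delta>)
  case 0
  have "window_prob \<epsilon> (M n) t {} = (if t * M n < 0 then 1 else 0)" for n
    by (simp add: window_prob_def prob_space)
  then have "window_prob \<epsilon> (M n) t {} = (if t < 0 then 1 else 0)" if "0 < M n" for n
    using that by (auto simp: mult_less_0_iff)
  then show ?case using 0
    by (intro eventually_mono[OF M_pos]) auto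
next
  case (Suc j)
  obtain N where N: "1 / real (Suc N) < \<delta> / 2" using reals_Archimedean[of "\<delta> / 2"] Suc.prems by (auto simp: field_simps)
  define h where "h = (1 - \<epsilon>) / real (Suc N)"
  define g where "g = (\<lambda>l. \<epsilon> + h * real l)"
  have "0 \<le> h" using \<epsilon> by (simp add: h_def)
  then have "mono g" by (auto simp: g_def mono_def intro!: mult_left_mono)
  moreover have "h * real (Suc N) = 1 - \<epsilon>" by (simp add: h_def)
  ultimately have g: "mono g" "g 0 = \<epsilon>" "g (Suc N) = 1" "\<And>l. g (Suc l) \<le> g l + h"
    unfolding g_def by (auto simp: algebra_simps)
  have h: "h \<le> \<delta> / 2"
  proof -
    have "h \<le> 1 / real (Suc N)" unfolding h_def using \<epsilon> by (intro divide_right_mono) auto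
    then show ?thesis using N by linarith
  qed
  have gpos: "0 < g l" for l using monoD[OF g(1), of 0 l] g(2) \<epsilon> by simp
  define V where "V = \<epsilon> powr -\<alpha> - 1"
  have "0 \<le> V" unfolding V_def using powr_mono2'[of "-\<alpha>" \<epsilon> 1] \<alpha> \<epsilon> by simp
  \<comment> \<open>The first bound leaves \<delta> / 2 for the mesh, so level shift and mesh
    together stay within \<delta>. The second keeps the accumulated additive error
    \<open>\<delta>' * V\<close> below \<delta>, as the cell weights sum to the total mass
    \<open>V\<close>.\<close>
  define \<delta>' where "\<delta>' = min (\<delta> / 2) (\<delta> / (2 * (V + 1)))"
  have \<delta>': "0 < \<delta>'" "\<delta>' \<le> \<delta> / 2" "\<delta>' * V < \<delta>"
  proof -
    show "0 < \<delta>'" using Suc.prems \<open>0 \<le> V\<close> by (auto simp: \<delta>'_def)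
    show "\<delta>' \<le> \<delta> / 2" unfolding \<delta>'_def by (rule min.cobounded1)
    have "\<delta>' * V \<le> \<delta> / (2 * (V + 1)) * V" using \<open>0 \<le> V\<close> by (intro mult_right_mono) (auto simp: \<delta>'_def)
    also have "\<dots> < \<delta>" using Suc.prems \<open>0 \<le> V\<close> by (simp add: field_simps) (smt (verit) mult_nonneg_nonneg)
    finally show "\<delta>' * V < \<delta>" .
  qed
  define v where "v = (\<lambda>l. g l powr -\<alpha> - g (Suc l) powr -\<alpha>)"
  define w where "w = (\<lambda>n l. tail (g l * M n) - tail (g (Suc l) * M n))"
  have sum_v: "(\<Sum>l<Suc N. v l) = V"
    unfolding v_def V_def using sum_lessThan_telescope'[of "\<lambda>l. g l powr -\<alpha>" "Suc N"] g by simp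
  \<comment> \<open>The grid is fixed while n grows, so regular variation at its finitely many
    points suffices; the strict inequalities for the limits then hold eventually.\<close>
  have lim: "(\<lambda>n. \<Sum>l<Suc N. w n l / tail (M n) * b l) \<longlonglongrightarrow> (\<Sum>l<Suc N. v l * b l)" for b
    unfolding w_def v_def diff_divide_distrib by (intro tendsto_intros tail_lim gpos)
  let ?U = "\<lambda>l. d j (t - g (Suc l) - \<delta>') + \<delta>'" and ?L = "\<lambda>l. d j (t - g l + \<delta>') - \<delta>'"
  have "(\<Sum>l<Suc N. v l * ?U l) = (\<Sum>l<Suc N. v l * d j (t - \<delta>' - g (Suc l))) + \<delta>' * V"
    unfolding sum_v[symmetric] sum_distrib_left sum.distrib[symmetric]
    by (intro sum.cong refl) (simp only: distrib_left mult.commute[of \<delta>'] cancel_ab_semigroup_add_class.diff_right_commute[of t _ \<delta>'])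
  also have "\<dots> \<le> d (Suc j) (t - \<delta>' - h) + \<delta>' * V"
    unfolding v_def using grid_sum_le_conv_tail(1)[OF \<alpha> \<epsilon> g, of j "t - \<delta>'"] by simp
  also have "d (Suc j) (t - \<delta>' - h) \<le> d (Suc j) (t - \<delta>)"
    using h \<delta>' conv_tail_jump_finite[OF \<alpha> \<epsilon>, of "Suc j" "t - \<delta>"]
    by (intro enn2real_mono conv_tail_antimono) auto
  finally have "(\<Sum>l<Suc N. v l * ?U l) < d (Suc j) (t - \<delta>) + \<delta>" using \<delta>' by linarith
  then have U: "\<forall>\<^sub>F n in sequentially. (\<Sum>l<Suc N. w n l / tail (M n) * ?U l) < d (Suc j) (t - \<delta>) + \<delta>"
    by (rule order_tendstoD(2)[OF lim])
  have "d (Suc j) (t + \<delta>) \<le> d (Suc j) (t + \<delta>' + h)"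
    using h \<delta>' conv_tail_jump_finite[OF \<alpha> \<epsilon>, of "Suc j" "t + \<delta>' + h"]
    by (intro enn2real_mono conv_tail_antimono) auto
  also have "\<dots> \<le> (\<Sum>l<Suc N. v l * d j (t + \<delta>' - g l))"
    unfolding v_def using grid_sum_le_conv_tail(2)[OF \<alpha> \<epsilon> g, of j "t + \<delta>'"] by simp
  also have "\<dots> = (\<Sum>l<Suc N. v l * ?L l) + \<delta>' * V"
    unfolding sum_v[symmetric] sum_distrib_left sum.distrib[symmetric] by (intro sum.cong refl) (simp add: algebra_simps)
  finally have "d (Suc j) (t + \<delta>) - \<delta> < (\<Sum>l<Suc N. v l * ?L l)" using \<delta>' by linarith
  then have L: "\<forall>\<^sub>F n in sequentially. d (Suc j) (t + \<delta>) - \<delta> < (\<Sum>l<Suc N. w n l / tail (M n) * ?L l)"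
    by (rule order_tendstoD(1)[OF lim])
  \<comment> \<open>The quantifier over \<open>I\<close> stays inside the filter: the bounds are
    later used for all index sets in {1..n}, whose number grows with n.\<close>
  have IH: "\<forall>\<^sub>F n in sequentially. \<forall>l\<in>{..<Suc N}. (\<forall>I. finite I \<longrightarrow> card I = j \<longrightarrow>
      window_prob \<epsilon> (M n) (t - g (Suc l)) I \<le> ?U l * tail (M n) ^ j) \<and>
      (\<forall>I. finite I \<longrightarrow> card I = j \<longrightarrow> ?L l * tail (M n) ^ j \<le> window_prob \<epsilon> (M n) (t - g l) I)"
  proof (intro eventually_ball_finite ballI finite_lessThan eventually_conj)
    fix l
    show "\<forall>\<^sub>F n in sequentially. \<forall>I. finite I \<longrightarrow> card I = j \<longrightarrow>
        window_prob \<epsilon> (M n) (t - g (Suc l)) I \<le> ?U l * tail (M n) ^ j"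
      using Suc.IH[OF \<delta>'(1), of "t - g (Suc l)"] by (rule eventually_mono) blast
    show "\<forall>\<^sub>F n in sequentially. \<forall>I. finite I \<longrightarrow> card I = j \<longrightarrow> ?L l * tail (M n) ^ j \<le> window_prob \<epsilon> (M n) (t - g l) I"
      using Suc.IH[OF \<delta>'(1), of "t - g l"] by (rule eventually_mono) blast
  qed
  show ?case
    using U L IH M_pos
  proof eventually_elim
    case (elim n)
    let ?q = "tail (M n)"
    have q: "0 < ?q" by (rule tail_pos)
    have w0: "0 \<le> w n l" for l
      using monoD[OF g(1), of l "Suc l"] elim by (auto simp: w_def intro!: tail_antimono mult_right_mono)
    have scale: "(\<Sum>l<Suc N. w n l * (b l * ?q ^ j)) = (\<Sum>l<Suc N. w n l / ?q * b l) * ?q ^ Suc j" for b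
      unfolding sum_distrib_right using q by (intro sum.cong refl) simp
    show ?case
    proof (intro allI impI)
      fix I' :: "nat set" assume "finite I'" "card I' = Suc j"
      then obtain i I where I: "I' = insert i I" "i \<notin> I" "finite I" "card I = j"
        by (metis card_Suc_eq_finite)
      have "window_prob \<epsilon> (M n) t I' \<le> (\<Sum>l<Suc N. w n l * window_prob \<epsilon> (M n) (t - g (Suc l)) I)"
        unfolding I(1) w_def using I elim g by (intro window_prob_insert_le) auto
      also have "\<dots> \<le> (\<Sum>l<Suc N. w n l * (?U l * ?q ^ j))"
        using elim I by (intro sum_mono mult_left_mono w0) blast
      also have "\<dots> \<le> (d (Suc j) (t - \<delta>) + \<delta>) * ?q ^ Suc j"
        unfolding scale using elim q by (intro mult_right_mono) auto
      finally have up: "window_prob \<epsilon> (M n) t I' \<le> (d (Suc j) (t - \<delta>) + \<delta>) * ?q ^ Suc j" .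
      have "(d (Suc j) (t + \<delta>) - \<delta>) * ?q ^ Suc j \<le> (\<Sum>l<Suc N. w n l * (?L l * ?q ^ j))"
        unfolding scale using elim q by (intro mult_right_mono) auto
      also have "\<dots> \<le> (\<Sum>l<Suc N. w n l * window_prob \<epsilon> (M n) (t - g l) I)"
        using elim I by (intro sum_mono mult_left_mono w0) blast
      also have "\<dots> \<le> window_prob \<epsilon> (M n) t I'"
        unfolding I(1) w_def using I elim g by (intro window_prob_insert_ge) auto
      finally show "window_prob \<epsilon> (M n) t I' \<le> (d (Suc j) (t - \<delta>) + \<delta>) * ?q ^ Suc j \<and>
        (d (Suc j) (t + \<delta>) - \<delta>) * ?q ^ Suc j \<le> window_prob \<epsilon> (M n) t I'" using up by blast
    qed
  qed
qed

end

end

section \<open>Bounds for a fixed number of summands\<close>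

lemma binomial_le_power_div_fact: "real (n choose i) \<le> real n ^ i / fact i"
proof -
  have "(n choose i) * fact i \<le> n ^ i" by (rule binomial_fact_pow)
  then have "real ((n choose i) * fact i) \<le> real (n ^ i)" by (simp only: of_nat_le_iff)
  then show ?thesis by (simp add: field_simps)
qed

lemma binomial_le_power: "real (n choose i) \<le> real n ^ i"
proof -
  have "real n ^ i / fact i \<le> real n ^ i / 1" by (intro divide_left_mono) auto
  then show ?thesis using binomial_le_power_div_fact[of n i] unfolding div_by_1 by (rule order_trans[rotated])
qed

text \<open>Nonpositive values are sent to 0: in the upper bound negative summands only lower the
  sum and may be dropped. The lower bound applies it to absolute values.\<close>

definition small_part :: "real \<Rightarrow> real \<Rightarrow> real" where
  "small_part c y = y * indicator {0<..c} y"

lemma small_part_measurable [measurable]: "small_part c \<in> borel_measurable borel"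
  unfolding small_part_def by measurable

lemma small_part_bounds: "0 \<le> small_part c y" "0 \<le> c \<Longrightarrow> small_part c y \<le> c"
  by (auto simp: small_part_def split: split_indicator)

text \<open>A purely deterministic case split on the number of big summands. Truncated and
  nonpositive terms add at most 0, so the big ones plus the small remainder R exceed k m. For k + 1
  big ones the split at \<delta> m separates the main term from a rare remainder; for k of them the
  split at u m marks the range where the local condition will apply.\<close>

lemma truncated_sum_gt_cases:
  fixes m \<epsilon> \<delta> u :: real
  assumes "finite J" "0 < m" "0 < \<epsilon>" "\<epsilon> \<le> 1" "1 \<le> k"
    and gt: "(\<Sum>j\<in>J. y j * indicator {y. \<bar>y\<bar> \<le> m} (y j)) > real k * m"
  shows "(\<exists>I\<subseteq>J. card I = k + 2 \<and> (\<forall>i\<in>I. y i \<in> {\<epsilon> * m<..m})) \<or>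
    (\<exists>I\<subseteq>J. card I = k + 1 \<and> (\<forall>i\<in>I. y i \<in> {\<epsilon> * m<..m}) \<and> (\<Sum>i\<in>I. y i) > (real k - \<delta>) * m) \<or>
    (\<exists>I\<subseteq>J. card I = k + 1 \<and> (\<forall>i\<in>I. y i \<in> {\<epsilon> * m<..m}) \<and> (\<Sum>j\<in>J - I. small_part (\<epsilon> * m) (y j)) \<ge> \<delta> * m) \<or>
    (\<exists>I\<subseteq>J. card I = k \<and> (\<forall>i\<in>I. y i \<in> {\<epsilon> * m<..m}) \<and> (\<Sum>j\<in>J - I. small_part (\<epsilon> * m) (y j)) \<ge> u * m) \<or>
    (\<exists>I\<subseteq>J. card I = k \<and> (\<forall>i\<in>I. m - (\<Sum>j\<in>J - I. small_part (\<epsilon> * m) (y j)) < y i \<and> y i \<le> m) \<and>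
       (\<Sum>j\<in>J - I. small_part (\<epsilon> * m) (y j)) \<le> u * m) \<or>
    (\<Sum>j\<in>J. small_part (\<epsilon> * m) (y j)) \<ge> m"
proof -
  define B where "B = {j \<in> J. y j \<in> {\<epsilon> * m<..m}}"
  define R where "R = (\<Sum>j\<in>J - B. small_part (\<epsilon> * m) (y j))"
  have B: "B \<subseteq> J" "finite B" "\<forall>i\<in>B. y i \<in> {\<epsilon> * m<..m}" using \<open>finite J\<close> by (auto simp: B_def)
  have em: "0 < \<epsilon> * m" "\<epsilon> * m \<le> m" using assms by auto
  have "(\<Sum>j\<in>J. y j * indicator {y. \<bar>y\<bar> \<le> m} (y j)) =
     (\<Sum>j\<in>B. y j * indicator {y. \<bar>y\<bar> \<le> m} (y j)) + (\<Sum>j\<in>J - B. y j * indicator {y. \<bar>y\<bar> \<le> m} (y j))"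
    using B \<open>finite J\<close> by (intro sum.subset_diff[of B J, simplified add.commute]) auto
  also have "\<dots> \<le> (\<Sum>j\<in>B. y j) + R"
    unfolding R_def using em
    by (intro add_mono sum_mono) (auto simp: B_def small_part_def split: split_indicator)
  finally have SR: "(\<Sum>j\<in>B. y j) + R > real k * m" using gt by simp
  have Rle: "R \<le> (\<Sum>j\<in>J. small_part (\<epsilon> * m) (y j))"
    unfolding R_def using \<open>finite J\<close> small_part_bounds(1) by (intro sum_mono2) auto
  consider "card B \<ge> k + 2" | "card B = k + 1" | "card B = k" | "card B < k" by linarith
  then show ?thesis
  proof cases
    case 1
    then obtain I where "I \<subseteq> B" "card I = k + 2" using obtain_subset_with_card_n by metis
    then show ?thesis using B by (intro disjI1 exI[of _ I]) blast
  next
    case 2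
    show ?thesis
    proof (cases "R \<ge> \<delta> * m")
      case True
      then show ?thesis using B 2 unfolding R_def by (intro disjI2[OF disjI2[OF disjI1]] exI[of _ B]) blast
    next
      case False
      then have "(\<Sum>j\<in>B. y j) > (real k - \<delta>) * m" using SR by (simp add: algebra_simps)
      then show ?thesis using B 2 by (intro disjI2[OF disjI1] exI[of _ B]) blast
    qed
  next
    case 3
    show ?thesis
    proof (cases "R \<ge> u * m")
      case True
      then show ?thesis using B 3 unfolding R_def by (intro disjI2[OF disjI2[OF disjI2[OF disjI1]]] exI[of _ B]) blast
    next
      case False
      \<comment> \<open>The other k - 1 big summands add at most (k - 1) m, so this one alone must
        make up for m - R.\<close>
      have "m - R < y i" if "i \<in> B" for i
      proof -
        have "(\<Sum>j\<in>B. y j) = y i + (\<Sum>j\<in>B - {i}. y j)" using that B(2) by (simp add: sum.remove)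
        also have "(\<Sum>j\<in>B - {i}. y j) \<le> (\<Sum>j\<in>B - {i}. m)" using B(3) by (intro sum_mono) auto
        also have "\<dots> = (real k - 1) * m" using that B(2) 3 \<open>1 \<le> k\<close> by (simp add: of_nat_diff)
        finally show ?thesis using SR by (simp add: algebra_simps)
      qed
      then show ?thesis using B 3 False unfolding R_def
        by (intro disjI2[OF disjI2[OF disjI2[OF disjI2[OF disjI1]]]] exI[of _ B]) auto
    qed
  next
    case 4
    have "(\<Sum>j\<in>B. y j) \<le> (\<Sum>j\<in>B. m)" using B(3) by (intro sum_mono) auto
    also have "\<dots> = real (card B) * m" by simp
    also have "\<dots> \<le> (real k - 1) * m" using 4 \<open>0 < m\<close> by (intro mult_right_mono) auto
    finally have "m \<le> R" using SR by (simp add: algebra_simps)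
    then show ?thesis using Rle by linarith
  qed
qed

context iid_seq
begin

lemma prob_Union_card_le:
  assumes "finite J" "\<And>I. I \<subseteq> J \<Longrightarrow> card I = i \<Longrightarrow> A I \<in> events"
    and "\<And>I. I \<subseteq> J \<Longrightarrow> card I = i \<Longrightarrow> prob (A I) \<le> b"
  shows "prob (\<Union>I\<in>{I. I \<subseteq> J \<and> card I = i}. A I) \<le> real (card J choose i) * b"
proof -
  have fin: "finite {I. I \<subseteq> J \<and> card I = i}" using assms(1) by simp
  have "prob (\<Union>I\<in>{I. I \<subseteq> J \<and> card I = i}. A I) \<le> (\<Sum>I\<in>{I. I \<subseteq> J \<and> card I = i}. prob (A I))"
    using assms(2) fin by (intro finite_measure_subadditive_finite) auto
  also have "\<dots> \<le> (\<Sum>I\<in>{I. I \<subseteq> J \<and> card I = i}. b)"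
    using assms(3) by (intro sum_mono) auto
  finally show ?thesis using n_subsets[OF assms(1), of i] by simp
qed

lemma integrable_small_part: "0 \<le> c \<Longrightarrow> integrable P (\<lambda>\<omega>. small_part c (Y 0 \<omega>))"
  using small_part_bounds[of c] by (intro integrable_const_bound[of _ c]) auto

text \<open>Only the coefficient of x^(k+1) survives the limit: \<open>D\<close> carries the main
  term and \<open>C ^ k * L\<close> the case of k summands close to m. The cases of order x^(k+2)
  are bounded crudely.\<close>

lemma prob_truncated_sum_gt_le:
  fixes m \<epsilon> \<delta> u B L C D :: real and n k :: nat
  defines "q \<equiv> tail m" and "J \<equiv> {1..n}"
  defines "x \<equiv> real n * q"
  assumes "0 < m" "0 < \<epsilon>" "\<epsilon> \<le> 1" "2 * \<epsilon> \<le> u" "u \<le> 1" "(real k + 2) * \<epsilon> \<le> 1" "0 < \<delta>" "1 \<le> k" "1 \<le> n"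
    and q: "0 < q" and pos: "0 \<le> B" "0 < L" "0 \<le> C" "0 \<le> D"
    and big: "tail (\<epsilon> * m) \<le> B * q"
    and small: "expectation (\<lambda>\<omega>. small_part (\<epsilon> * m) (Y 0 \<omega>)) \<le> L * (m * q)"
    and near: "\<And>r. 0 \<le> r \<Longrightarrow> r \<le> u * m \<Longrightarrow> tail (m - r) - tail m \<le> C * q * (r / m)"
    and wind: "\<And>I. finite I \<Longrightarrow> card I = k + 1 \<Longrightarrow> window_prob \<epsilon> m (real k - \<delta>) I \<le> D * q ^ (k + 1)"
  shows "\<P>(\<omega> in P. (\<Sum>j\<in>J. Y j \<omega> * indicator {y. \<bar>y\<bar> \<le> m} (Y j \<omega>)) > real k * m) \<le>
    (D / fact (k + 1) + C ^ k * L) * x ^ (k + 1) +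
    (B ^ (k + 2) + B ^ (k + 1) * L / \<delta> + B ^ k * (exp 1 * (L / \<epsilon>) ^ 2) + exp 1 * (L / \<epsilon>) ^ (k + 2)) * x ^ (k + 2)"
proof -
  have J: "finite J" "card J = n" by (auto simp: J_def)
  have x: "0 < x" using q \<open>1 \<le> n\<close> by (simp add: x_def)
  let ?s = "small_part (\<epsilon> * m)"
  let ?e = "expectation (\<lambda>\<omega>. ?s (Y 0 \<omega>))"
  have em: "0 < \<epsilon> * m" "\<epsilon> * m \<le> m" using assms by auto
  have e0: "0 \<le> ?e" by (intro Bochner_Integration.integral_nonneg small_part_bounds)
  have ne: "real (card K) * ?e \<le> L * m * x" if "K \<subseteq> J" for K
  proof -
    have "card K \<le> n" using card_mono[OF J(1) that] J(2) by simp
    then have "real (card K) * ?e \<le> real n * (L * (m * q))" using small e0 by (intro mult_mono) auto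
    then show ?thesis by (simp add: x_def mult_ac)
  qed
  have int: "integrable P (\<lambda>\<omega>. ?s (Y 0 \<omega>))" using em by (intro integrable_small_part) simp
  have allbig: "\<P>(\<omega> in P. \<forall>i\<in>I. Y i \<omega> \<in> {\<epsilon> * m<..m}) \<le> (B * q) ^ card I" if "finite I" for I
  proof -
    have "\<P>(\<omega> in P. \<forall>i\<in>I. Y i \<omega> \<in> {\<epsilon> * m<..m}) = (tail (\<epsilon> * m) - tail m) ^ card I"
      using prob_all[OF that, of "{\<epsilon> * m<..m}"] prob_Ioc[OF em(2), of 0] by simp
    also have "\<dots> \<le> (B * q) ^ card I"
      using big q tail_antimono[OF em(2)] by (intro power_mono) (auto simp: q_def)
    finally show ?thesis .
  qed
  have rest_Markov: "\<P>(\<omega> in P. (\<Sum>j\<in>K. ?s (Y j \<omega>)) \<ge> \<delta> * m) \<le> L * x / \<delta>" if "K \<subseteq> J" for K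
  proof -
    have "\<P>(\<omega> in P. (\<Sum>j\<in>K. ?s (Y j \<omega>)) \<ge> \<delta> * m) \<le> real (card K) * ?e / (\<delta> * m)"
      using int finite_subset[OF that J(1)] assms small_part_bounds by (intro prob_sum_Markov) auto
    also have "\<dots> \<le> L * m * x / (\<delta> * m)" using ne[OF that] assms by (intro divide_right_mono) auto
    finally show ?thesis using \<open>0 < m\<close> by simp
  qed
  \<comment> \<open>Divided by \<epsilon> m the small parts lie in [0,1], and their sum is at least
    c / \<epsilon>, hence at least i. So the exponent is limited only by how small \<epsilon>
    is.\<close>
  have rest_Chernoff: "\<P>(\<omega> in P. (\<Sum>j\<in>K. ?s (Y j \<omega>)) \<ge> c * m) \<le> exp 1 * (L / \<epsilon> * x) ^ i"
    if "K \<subseteq> J" "real i * \<epsilon> \<le> c" for K i c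
  proof -
    have "\<P>(\<omega> in P. (\<Sum>j\<in>K. ?s (Y j \<omega>)) \<ge> c * m) \<le> \<P>(\<omega> in P. (\<Sum>j\<in>K. ?s (Y j \<omega>) / (\<epsilon> * m)) \<ge> real i)"
    proof (intro finite_measure_mono)
      have *: "real i * (\<epsilon> * m) \<le> c * m" unfolding mult.assoc[symmetric] using that(2) \<open>0 < m\<close> by (intro mult_right_mono) auto
      show "{\<omega> \<in> space P. (\<Sum>j\<in>K. ?s (Y j \<omega>)) \<ge> c * m} \<subseteq> {\<omega> \<in> space P. (\<Sum>j\<in>K. ?s (Y j \<omega>) / (\<epsilon> * m)) \<ge> real i}"
        using em by (auto simp: sum_divide_distrib[symmetric] pos_le_divide_eq dest: order_trans[OF *])
    qed measurable
    also have "\<dots> \<le> exp 1 * (L / \<epsilon> * x) ^ i"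
    proof (intro prob_sum_Chernoff)
      show "real (card K) * expectation (\<lambda>\<omega>. ?s (Y 0 \<omega>) / (\<epsilon> * m)) \<le> L / \<epsilon> * x"
        using ne[OF that(1)] em assms by (simp add: field_simps)
      show "0 \<le> ?s y / (\<epsilon> * m)" "?s y / (\<epsilon> * m) \<le> 1" for y
        using small_part_bounds[of "\<epsilon> * m" y] em by auto
    qed (use that finite_subset[OF that(1) J(1)] pos x \<open>0 < \<epsilon>\<close> in auto)
    finally show ?thesis .
  qed
  have split: "\<P>(\<omega> in P. (\<forall>i\<in>I. Y i \<omega> \<in> {\<epsilon> * m<..m}) \<and> (\<Sum>j\<in>J - I. ?s (Y j \<omega>)) \<ge> c * m) =
     \<P>(\<omega> in P. \<forall>i\<in>I. Y i \<omega> \<in> {\<epsilon> * m<..m}) * \<P>(\<omega> in P. (\<Sum>j\<in>J - I. ?s (Y j \<omega>)) \<ge> c * m)" if "I \<subseteq> J" for I c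
    using prob_indep_blocks[of I "J - I" "\<lambda>x. x" ?s "{\<epsilon> * m<..m}" UNIV UNIV "{c * m..}"] finite_subset[OF that J(1)] J(1)
    by simp
  \<comment> \<open>The events mirror the six cases of the deterministic split; \<open>E3\<close>
    serves twice, with thresholds \<delta> and u.\<close>
  define E1 where "E1 = (\<lambda>I. {\<omega> \<in> space P. \<forall>i\<in>I. Y i \<omega> \<in> {\<epsilon> * m<..m}})"
  define E2 where "E2 = (\<lambda>I. {\<omega> \<in> space P. (\<forall>i\<in>I. Y i \<omega> \<in> {\<epsilon> * m<..m}) \<and> (\<Sum>i\<in>I. Y i \<omega>) \<in> {(real k - \<delta>) * m<..}})"
  define E3 where "E3 = (\<lambda>c I. {\<omega> \<in> space P. (\<forall>i\<in>I. Y i \<omega> \<in> {\<epsilon> * m<..m}) \<and> (\<Sum>j\<in>J - I. ?s (Y j \<omega>)) \<ge> c * m})"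
  define E4 where "E4 = (\<lambda>I. {\<omega> \<in> space P. (\<forall>i\<in>I. m - (\<Sum>j\<in>J - I. ?s (Y j \<omega>)) < Y i \<omega> \<and> Y i \<omega> \<le> m) \<and> (\<Sum>j\<in>J - I. ?s (Y j \<omega>)) \<le> u * m})"
  define E5 where "E5 = {\<omega> \<in> space P. (\<Sum>j\<in>J. ?s (Y j \<omega>)) \<ge> 1 * m}"
  have meas: "E1 I \<in> events" "E2 I \<in> events" "E3 c I \<in> events" "E4 I \<in> events" if "I \<subseteq> J" for I c
  proof -
    have [simp]: "finite I" using finite_subset[OF that J(1)] .
    show "E1 I \<in> events" "E2 I \<in> events" "E3 c I \<in> events" "E4 I \<in> events"
      unfolding E1_def E2_def E3_def E4_def by measurable
  qed
  have E5[measurable]: "E5 \<in> events" unfolding E5_def by measurable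
  let ?U = "\<lambda>i E. \<Union>I\<in>{I. I \<subseteq> J \<and> card I = i}. E I"
  have U: "?U i E1 \<in> events" "?U i E2 \<in> events" "?U i (E3 c) \<in> events" "?U i E4 \<in> events" for i c
    using meas J(1) by (auto intro!: sets.finite_UN)
  have sub: "{\<omega> \<in> space P. (\<Sum>j\<in>J. Y j \<omega> * indicator {y. \<bar>y\<bar> \<le> m} (Y j \<omega>)) > real k * m} \<subseteq>
    ?U (k + 2) E1 \<union> (?U (k + 1) E2 \<union> (?U (k + 1) (E3 \<delta>) \<union> (?U k (E3 u) \<union> (?U k E4 \<union> E5))))"
  proof
    fix \<omega> assume \<omega>: "\<omega> \<in> {\<omega> \<in> space P. (\<Sum>j\<in>J. Y j \<omega> * indicator {y. \<bar>y\<bar> \<le> m} (Y j \<omega>)) > real k * m}"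
    have "(\<Sum>j\<in>J. Y j \<omega> * indicator {y. \<bar>y\<bar> \<le> m} (Y j \<omega>)) > real k * m" using \<omega> by blast
    from truncated_sum_gt_cases[OF J(1) \<open>0 < m\<close> \<open>0 < \<epsilon>\<close> \<open>\<epsilon> \<le> 1\<close> \<open>1 \<le> k\<close> this, of \<delta> u] \<omega>
    show "\<omega> \<in> ?U (k + 2) E1 \<union> (?U (k + 1) E2 \<union> (?U (k + 1) (E3 \<delta>) \<union> (?U k (E3 u) \<union> (?U k E4 \<union> E5))))"
      unfolding E1_def E2_def E3_def E4_def E5_def UN_iff Un_iff mem_Collect_eq greaterThan_iff mult_1 by blast
  qed
  have "\<P>(\<omega> in P. (\<Sum>j\<in>J. Y j \<omega> * indicator {y. \<bar>y\<bar> \<le> m} (Y j \<omega>)) > real k * m) \<le>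
     prob (?U (k + 2) E1 \<union> (?U (k + 1) E2 \<union> (?U (k + 1) (E3 \<delta>) \<union> (?U k (E3 u) \<union> (?U k E4 \<union> E5)))))"
    by (intro finite_measure_mono sub sets.Un U E5)
  also have "\<dots> \<le> prob (?U (k + 2) E1) + (prob (?U (k + 1) E2) + (prob (?U (k + 1) (E3 \<delta>)) + (prob (?U k (E3 u)) + (prob (?U k E4) + prob E5))))"
    by (intro order_trans[OF measure_Un_le] add_left_mono order_refl sets.Un U E5)
  finally have total: "\<P>(\<omega> in P. (\<Sum>j\<in>J. Y j \<omega> * indicator {y. \<bar>y\<bar> \<le> m} (Y j \<omega>)) > real k * m) \<le>
    prob (?U (k + 2) E1) + (prob (?U (k + 1) E2) + (prob (?U (k + 1) (E3 \<delta>)) + (prob (?U k (E3 u)) + (prob (?U k E4) + prob E5))))" .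
  have t1: "prob (?U (k + 2) E1) \<le> B ^ (k + 2) * x ^ (k + 2)"
  proof -
    have "prob (?U (k + 2) E1) \<le> real (card J choose (k + 2)) * (B * q) ^ (k + 2)"
    proof (intro prob_Union_card_le J(1) meas)
      fix I assume I: "I \<subseteq> J" "card I = k + 2"
      show "prob (E1 I) \<le> (B * q) ^ (k + 2)"
        unfolding E1_def I(2)[symmetric] using finite_subset[OF I(1) J(1)] by (rule allbig)
    qed
    also have "\<dots> \<le> real n ^ (k + 2) * (B * q) ^ (k + 2)"
      unfolding J(2) using pos q by (intro mult_right_mono binomial_le_power) auto
    finally show ?thesis by (simp add: x_def power_mult_distrib mult_ac)
  qed
  \<comment> \<open>Here the factor 1 / (k + 1)! of the binomial coefficient must be kept, because
    it enters the limit. The other terms use the cruder n^i.\<close>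
  have t2: "prob (?U (k + 1) E2) \<le> D / fact (k + 1) * x ^ (k + 1)"
  proof -
    have "prob (?U (k + 1) E2) \<le> real (card J choose (k + 1)) * (D * q ^ (k + 1))"
    proof (intro prob_Union_card_le J(1) meas)
      fix I assume I: "I \<subseteq> J" "card I = k + 1"
      show "prob (E2 I) \<le> D * q ^ (k + 1)"
        unfolding E2_def using wind[OF finite_subset[OF I(1) J(1)] I(2)] unfolding window_prob_def .
    qed
    also have "\<dots> \<le> real n ^ (k + 1) / fact (k + 1) * (D * q ^ (k + 1))"
      unfolding J(2) using pos q by (intro mult_right_mono binomial_le_power_div_fact) auto
    finally show ?thesis by (simp add: x_def power_mult_distrib mult_ac)
  qed
  \<comment> \<open>The k + 1 big summands already give x^(k+1), so the single power from Markov's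
    inequality suffices.\<close>
  have t3: "prob (?U (k + 1) (E3 \<delta>)) \<le> B ^ (k + 1) * L / \<delta> * x ^ (k + 2)"
  proof -
    have "prob (?U (k + 1) (E3 \<delta>)) \<le> real (card J choose (k + 1)) * ((B * q) ^ (k + 1) * (L * x / \<delta>))"
    proof (intro prob_Union_card_le J(1) meas)
      fix I assume I: "I \<subseteq> J" "card I = k + 1"
      show "prob (E3 \<delta> I) \<le> (B * q) ^ (k + 1) * (L * x / \<delta>)"
        unfolding E3_def split[OF I(1)] I(2)[symmetric] using finite_subset[OF I(1) J(1)] pos q
        by (intro mult_mono allbig rest_Markov) auto
    qed
    also have "\<dots> \<le> real n ^ (k + 1) * ((B * q) ^ (k + 1) * (L * x / \<delta>))"
      unfolding J(2) using pos q x \<open>0 < \<delta>\<close> by (intro mult_right_mono binomial_le_power) auto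
    finally show ?thesis by (simp add: x_def power_mult_distrib mult_ac)
  qed
  \<comment> \<open>With only k big summands the remainder must supply two powers of x; this is the
    purpose of 2 \<epsilon> \<le> u.\<close>
  have t4: "prob (?U k (E3 u)) \<le> B ^ k * (exp 1 * (L / \<epsilon>) ^ 2) * x ^ (k + 2)"
  proof -
    have "prob (?U k (E3 u)) \<le> real (card J choose k) * ((B * q) ^ k * (exp 1 * (L / \<epsilon> * x) ^ 2))"
    proof (intro prob_Union_card_le J(1) meas)
      fix I assume I: "I \<subseteq> J" "card I = k"
      show "prob (E3 u I) \<le> (B * q) ^ k * (exp 1 * (L / \<epsilon> * x) ^ 2)"
        unfolding E3_def split[OF I(1)] I(2)[symmetric] using finite_subset[OF I(1) J(1)] pos q \<open>2 * \<epsilon> \<le> u\<close>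
        by (intro mult_mono allbig rest_Chernoff) auto
    qed
    also have "\<dots> \<le> real n ^ k * ((B * q) ^ k * (exp 1 * (L / \<epsilon> * x) ^ 2))"
      unfolding J(2) using pos q x \<open>0 < \<epsilon>\<close> by (intro mult_right_mono binomial_le_power) auto
    also have "\<dots> = B ^ k * (exp 1 * (L / \<epsilon>) ^ 2) * x ^ (k + 2)"
      by (simp only: power_add x_def power_mult_distrib mult_ac)
    finally show ?thesis .
  qed
  have t5: "prob (?U k E4) \<le> C ^ k * L * x ^ (k + 1)"
  proof -
    have "prob (?U k E4) \<le> real (card J choose k) * ((C * q) ^ k * (L * x))"
    proof (intro prob_Union_card_le J(1) meas)
      fix I assume I: "I \<subseteq> J" "card I = k"
      have "prob (E4 I) \<le> (C * q) ^ card I * (real (card (J - I)) * ?e / m)"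
        unfolding E4_def
      proof (intro prob_window_le)
        show "\<P>(\<omega> in P. Y 0 \<omega> \<in> {m - r<..m}) \<le> C * q * (r / m)" if "0 \<le> r" "r \<le> u * m" for r
          using near[OF that] prob_Ioc[of "m - r" m 0] that by simp
        show "I \<noteq> {}" using I \<open>1 \<le> k\<close> by auto
        show "u * m \<le> m" using \<open>u \<le> 1\<close> \<open>0 < m\<close> by simp
      qed (use I finite_subset[OF I(1) J(1)] J int small_part_bounds \<open>0 < m\<close> pos q in auto)
      also have "\<dots> \<le> (C * q) ^ k * (L * x)"
        unfolding I(2) using ne[of "J - I"] pos q \<open>0 < m\<close> by (intro mult_left_mono) (auto simp: field_simps)
      finally show "prob (E4 I) \<le> (C * q) ^ k * (L * x)" .
    qed
    also have "\<dots> \<le> real n ^ k * ((C * q) ^ k * (L * x))"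
      unfolding J(2) using pos q x by (intro mult_right_mono binomial_le_power) auto
    finally show ?thesis by (simp add: x_def power_mult_distrib mult_ac)
  qed
  \<comment> \<open>Here the small parts alone supply all k + 2 powers, by (k + 2) \<epsilon> \<le>
    1.\<close>
  have t6: "prob E5 \<le> exp 1 * (L / \<epsilon>) ^ (k + 2) * x ^ (k + 2)"
  proof -
    have "prob E5 \<le> exp 1 * (L / \<epsilon> * x) ^ (k + 2)"
      unfolding E5_def using \<open>(real k + 2) * \<epsilon> \<le> 1\<close> by (intro rest_Chernoff) (simp_all add: add.commute)
    then show ?thesis by (simp only: power_mult_distrib mult_ac)
  qed
  show ?thesis
    using total t1 t2 t3 t4 t5 t6 unfolding distrib_right by linarith
qed

text \<open>The surplus \<epsilon> m in the window level pays for the worst negative contribution of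
  the other summands. Independence of the two blocks turns each event into a product, and
  \<open>r\<close> bounds the probability that the rest misbehaves.\<close>

lemma prob_truncated_sum_gt_ge:
  fixes m \<epsilon> w r :: real and n k :: nat
  defines "J \<equiv> {1..n}"
  assumes "0 < m" "0 < \<epsilon>" "\<epsilon> \<le> 1" and "0 \<le> w" "r \<le> 1"
    and wind: "\<And>I. finite I \<Longrightarrow> card I = k + 1 \<Longrightarrow> w \<le> window_prob \<epsilon> m (real k + \<epsilon>) I"
    and rest: "real n * \<P>(\<omega> in P. \<bar>Y 0 \<omega>\<bar> > m) +
      real n * expectation (\<lambda>\<omega>. small_part m \<bar>Y 0 \<omega>\<bar>) / (\<epsilon> * m) \<le> r"
  shows "real (n choose (k + 1)) * (w * (1 - r)) \<le>
    \<P>(\<omega> in P. (\<Sum>j\<in>J. Y j \<omega> * indicator {y. \<bar>y\<bar> \<le> m} (Y j \<omega>)) > real k * m)"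
proof -
  have J: "finite J" "card J = n" by (auto simp: J_def)
  have em: "0 < \<epsilon> * m" "\<epsilon> * m \<le> m" using assms by auto
  define F where "F = (\<lambda>I. {\<omega> \<in> space P. ((\<forall>i\<in>I. Y i \<omega> \<in> {\<epsilon> * m<..m}) \<and> (\<Sum>i\<in>I. Y i \<omega>) \<in> {(real k + \<epsilon>) * m<..}) \<and>
     (\<forall>j\<in>J - I. Y j \<omega> \<in> UNIV) \<and> (\<Sum>j\<in>J - I. \<bar>Y j \<omega>\<bar>) \<in> {..\<epsilon> * m}})"
  let ?\<I> = "{I. I \<subseteq> J \<and> card I = k + 1}"
  have [measurable]: "(\<lambda>y. small_part m \<bar>y\<bar>) \<in> borel_measurable borel" by measurable
  \<comment> \<open>Markov's inequality is applied to absolute values truncated at m, whose mean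
    Karamata's bound controls; the price is the probability that some absolute value exceeds m.
    Summing over all of \<open>J\<close> makes the bound uniform in \<open>I\<close>.\<close>
  have rest_prob: "1 - r \<le> \<P>(\<omega> in P. (\<forall>j\<in>J - I. Y j \<omega> \<in> UNIV) \<and> (\<Sum>j\<in>J - I. \<bar>Y j \<omega>\<bar>) \<in> {..\<epsilon> * m})" for I
  proof -
    define A where "A = (\<Union>j\<in>J. {\<omega> \<in> space P. Y j \<omega> \<in> {y. \<bar>y\<bar> > m}})"
    define A' where "A' = {\<omega> \<in> space P. (\<Sum>j\<in>J. small_part m \<bar>Y j \<omega>\<bar>) \<ge> \<epsilon> * m}"
    have [measurable]: "A \<in> events" "A' \<in> events" unfolding A_def A'_def by measurable
    have "prob A \<le> (\<Sum>j\<in>J. \<P>(\<omega> in P. Y j \<omega> \<in> {y. \<bar>y\<bar> > m}))"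
      unfolding A_def using J by (intro finite_measure_subadditive_finite) auto
    also have "\<dots> = (\<Sum>j\<in>J. \<P>(\<omega> in P. Y 0 \<omega> \<in> {y. \<bar>y\<bar> > m}))"
      by (intro sum.cong refl prob_ident) simp
    also have "\<dots> = real n * \<P>(\<omega> in P. \<bar>Y 0 \<omega>\<bar> > m)" by (simp add: J)
    finally have A: "prob A \<le> real n * \<P>(\<omega> in P. \<bar>Y 0 \<omega>\<bar> > m)" .
    have A': "prob A' \<le> real n * expectation (\<lambda>\<omega>. small_part m \<bar>Y 0 \<omega>\<bar>) / (\<epsilon> * m)"
    proof -
      have "integrable P (\<lambda>\<omega>. small_part m \<bar>Y 0 \<omega>\<bar>)"
        using small_part_bounds[of m] \<open>0 < m\<close> by (intro integrable_const_bound[of _ m]) auto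
      then show ?thesis unfolding A'_def
        using prob_sum_Markov[of J "\<lambda>y. small_part m \<bar>y\<bar>" "\<epsilon> * m"] J em small_part_bounds[of m] by simp
    qed
    have "space P - (A \<union> A') \<subseteq> {\<omega> \<in> space P. (\<forall>j\<in>J - I. Y j \<omega> \<in> UNIV) \<and> (\<Sum>j\<in>J - I. \<bar>Y j \<omega>\<bar>) \<in> {..\<epsilon> * m}}"
    proof
      fix \<omega> assume \<omega>: "\<omega> \<in> space P - (A \<union> A')"
      have "small_part m \<bar>Y j \<omega>\<bar> = \<bar>Y j \<omega>\<bar>" if "j \<in> J" for j
        using \<omega> that by (auto simp: A_def small_part_def not_less split: split_indicator)
      then have "(\<Sum>j\<in>J. \<bar>Y j \<omega>\<bar>) < \<epsilon> * m" using \<omega> by (auto simp: A'_def)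
      moreover have "(\<Sum>j\<in>J - I. \<bar>Y j \<omega>\<bar>) \<le> (\<Sum>j\<in>J. \<bar>Y j \<omega>\<bar>)" using J by (intro sum_mono2) auto
      ultimately show "\<omega> \<in> {\<omega> \<in> space P. (\<forall>j\<in>J - I. Y j \<omega> \<in> UNIV) \<and> (\<Sum>j\<in>J - I. \<bar>Y j \<omega>\<bar>) \<in> {..\<epsilon> * m}}" using \<omega> by simp
    qed
    then have "prob (space P - (A \<union> A')) \<le> \<P>(\<omega> in P. (\<forall>j\<in>J - I. Y j \<omega> \<in> UNIV) \<and> (\<Sum>j\<in>J - I. \<bar>Y j \<omega>\<bar>) \<in> {..\<epsilon> * m})"
      using J by (intro finite_measure_mono) measurable
    moreover have "prob (space P - (A \<union> A')) = 1 - prob (A \<union> A')" by (intro prob_compl) measurable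
    moreover have "prob (A \<union> A') \<le> prob A + prob A'" by (intro measure_Un_le) measurable
    ultimately show ?thesis using A A' rest by linarith
  qed
  have Fm: "F I \<in> events" if "I \<in> ?\<I>" for I
  proof -
    have "finite I" using that finite_subset J(1) by auto
    then show ?thesis unfolding F_def using J(1) by measurable
  qed
  have "real (n choose (k + 1)) * (w * (1 - r)) = (\<Sum>I\<in>?\<I>. w * (1 - r))"
    using n_subsets[OF J(1), of "k + 1"] J(2) by simp
  also have "\<dots> \<le> (\<Sum>I\<in>?\<I>. prob (F I))"
  proof (intro sum_mono)
    fix I assume I: "I \<in> ?\<I>"
    then have "finite I" using finite_subset J(1) by auto
    have "w * (1 - r) \<le> window_prob \<epsilon> m (real k + \<epsilon>) I *
      \<P>(\<omega> in P. (\<forall>j\<in>J - I. Y j \<omega> \<in> UNIV) \<and> (\<Sum>j\<in>J - I. \<bar>Y j \<omega>\<bar>) \<in> {..\<epsilon> * m})"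
      using wind[OF \<open>finite I\<close>] I rest_prob[of I] \<open>0 \<le> w\<close> \<open>r \<le> 1\<close> by (intro mult_mono) (auto simp: window_prob_def)
    also have "\<dots> = prob (F I)"
      unfolding F_def window_prob_def using J(1) \<open>finite I\<close>
      by (intro prob_indep_blocks[where f = "\<lambda>x. x", symmetric]) auto
    finally show "w * (1 - r) \<le> prob (F I)" .
  qed
  also have "\<dots> = prob (\<Union>I\<in>?\<I>. F I)"
  proof (intro finite_measure_finite_Union[symmetric])
    \<comment> \<open>Outside \<open>I\<close> each single absolute value is at most the sum, hence
      at most \<epsilon> m. Thus the outcome determines \<open>I\<close>, which gives
      disjointness.\<close>
    have "I = {j \<in> J. Y j \<omega> > \<epsilon> * m}" if "I \<in> ?\<I>" "\<omega> \<in> F I" for I \<omega>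
    proof -
      have "Y j \<omega> \<le> \<epsilon> * m" if "j \<in> J - I" for j
      proof -
        have "Y j \<omega> \<le> \<bar>Y j \<omega>\<bar>" by simp
        also have "\<dots> \<le> (\<Sum>j\<in>J - I. \<bar>Y j \<omega>\<bar>)" using that J(1) by (intro member_le_sum) auto
        also have "\<dots> \<le> \<epsilon> * m" using \<open>\<omega> \<in> F I\<close> by (simp add: F_def)
        finally show ?thesis .
      qed
      then show ?thesis using that by (fastforce simp: F_def)
    qed
    then show "disjoint_family_on F ?\<I>" unfolding disjoint_family_on_def by blast
    show "finite ?\<I>" using J(1) by simp
    show "F ` ?\<I> \<subseteq> events" using Fm by blast
  qed
  also have "\<dots> \<le> \<P>(\<omega> in P. (\<Sum>j\<in>J. Y j \<omega> * indicator {y. \<bar>y\<bar> \<le> m} (Y j \<omega>)) > real k * m)"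
  proof (intro finite_measure_mono)
    show "(\<Union>I\<in>?\<I>. F I) \<subseteq> {\<omega> \<in> space P. (\<Sum>j\<in>J. Y j \<omega> * indicator {y. \<bar>y\<bar> \<le> m} (Y j \<omega>)) > real k * m}"
    proof
      fix \<omega> assume "\<omega> \<in> (\<Union>I\<in>?\<I>. F I)"
      then obtain I where I: "I \<subseteq> J" "\<omega> \<in> F I" by blast
      have "real k * m < (\<Sum>i\<in>I. Y i \<omega>) - (\<Sum>j\<in>J - I. \<bar>Y j \<omega>\<bar>)"
        using I(2) by (simp add: F_def algebra_simps)
      also have "\<dots> = (\<Sum>i\<in>I. Y i \<omega>) + (\<Sum>j\<in>J - I. - \<bar>Y j \<omega>\<bar>)" by (simp add: sum_negf)
      also have "\<dots> \<le> (\<Sum>j\<in>I. Y j \<omega> * indicator {y. \<bar>y\<bar> \<le> m} (Y j \<omega>)) + (\<Sum>j\<in>J - I. Y j \<omega> * indicator {y. \<bar>y\<bar> \<le> m} (Y j \<omega>))"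
      proof (intro add_mono sum_mono)
        fix i assume "i \<in> I"
        then have "Y i \<omega> \<in> {\<epsilon> * m<..m}" using I(2) by (simp add: F_def)
        then show "Y i \<omega> \<le> Y i \<omega> * indicator {y. \<bar>y\<bar> \<le> m} (Y i \<omega>)" using em by simp
      qed (auto split: split_indicator)
      also have "\<dots> = (\<Sum>j\<in>J. Y j \<omega> * indicator {y. \<bar>y\<bar> \<le> m} (Y j \<omega>))"
        using I(1) J(1) by (subst sum.subset_diff[of I J]) auto
      finally show "\<omega> \<in> {\<omega> \<in> space P. (\<Sum>j\<in>J. Y j \<omega> * indicator {y. \<bar>y\<bar> \<le> m} (Y j \<omega>)) > real k * m}"
        using I(2) by (simp add: F_def)
    qed
  qed (use J(1) in measurable)
  finally show ?thesis .
qed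

end

section \<open>Asymptotics\<close>

lemma binomial_div_power_tendsto: "(\<lambda>n. real (n choose j) / real n ^ j) \<longlonglongrightarrow> 1 / fact j"
proof -
  have "(\<lambda>n. (\<Prod>i=0..<j. 1 - real i * (1 / real n)) / fact j) \<longlonglongrightarrow> (\<Prod>i=0..<j. 1 - real i * 0) / fact j"
    by (intro tendsto_intros lim_1_over_n) simp
  moreover have "\<forall>\<^sub>F n in sequentially. (\<Prod>i=0..<j. 1 - real i * (1 / real n)) / fact j = real (n choose j) / real n ^ j"
    using eventually_gt_at_top[of 0]
  proof eventually_elim
    case (elim n)
    have "(\<Prod>i=0..<j. 1 - real i * (1 / real n)) = (\<Prod>i=0..<j. (real n - real i) / real n)"
      using elim by (intro prod.cong) (auto simp: field_simps)
    also have "\<dots> = (\<Prod>i=0..<j. real n - real i) / real n ^ j"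
      by (simp add: prod_dividef)
    finally show ?case by (simp add: binomial_gbinomial gbinomial_prod_rev)
  qed
  ultimately show ?thesis by (simp add: tendsto_cong)
qed

text \<open>The part of the moment coming from values in (x/2, x] is at most x times the tail at
  x/2. This is the recursion that Karamata's bound takes as hypothesis.\<close>

lemma (in prob_space) expectation_small_part_halving:
  assumes [measurable]: "Z \<in> borel_measurable M" and "0 < x"
  shows "expectation (\<lambda>\<omega>. small_part x (Z \<omega>)) \<le>
    expectation (\<lambda>\<omega>. small_part (x / 2) (Z \<omega>)) + x * \<P>(\<omega> in M. x / 2 < Z \<omega>)"
proof -
  have int: "integrable M (\<lambda>\<omega>. Z \<omega> * indicator {0<..c} (Z \<omega>))" if "0 < c" for c
    using that by (intro integrable_const_bound[of _ c]) (auto split: split_indicator)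
  have ind: "{\<omega> \<in> space M. x / 2 < Z \<omega>} \<in> events" by measurable
  have "expectation (\<lambda>\<omega>. Z \<omega> * indicator {0<..x} (Z \<omega>)) \<le>
    expectation (\<lambda>\<omega>. Z \<omega> * indicator {0<..x / 2} (Z \<omega>) + x * indicator {\<omega> \<in> space M. x / 2 < Z \<omega>} \<omega>)"
    using int[of x] int[of "x / 2"] \<open>0 < x\<close> ind
    by (intro integral_mono Bochner_Integration.integrable_add integrable_mult_right integrable_real_indicator)
       (auto split: split_indicator simp: emeasure_eq_measure)
  also have "\<dots> = expectation (\<lambda>\<omega>. Z \<omega> * indicator {0<..x / 2} (Z \<omega>)) + x * \<P>(\<omega> in M. x / 2 < Z \<omega>)"
    using int[of "x / 2"] \<open>0 < x\<close> ind
    by (subst Bochner_Integration.integral_add) (auto intro!: integrable_real_indicator simp: emeasure_eq_measure)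
  finally show ?thesis unfolding small_part_def .
qed

lemma (in prob_space) expectation_small_part_le:
  fixes x :: real
  assumes [measurable]: "Z \<in> borel_measurable M" and "0 \<le> x"
  shows "expectation (\<lambda>\<omega>. small_part x (Z \<omega>)) \<le> x"
proof -
  have "expectation (\<lambda>\<omega>. Z \<omega> * indicator {0<..x} (Z \<omega>)) \<le> expectation (\<lambda>\<omega>. x)"
    using assms(2) by (intro integral_mono integrable_const_bound[of _ x]) (auto split: split_indicator)
  then show ?thesis by (simp add: prob_space small_part_def)
qed

lemma filterlim_mult_const_at_top: "0 < s \<Longrightarrow> filterlim (\<lambda>x. s * x) at_top (at_top :: real filter)"
  by (rule filterlim_tendsto_pos_mult_at_top[OF tendsto_const _ filterlim_ident])

locale heavy_tailed_seq = iid_seq +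
  fixes \<alpha> p :: real
  assumes \<alpha>: "0 < \<alpha>" "\<alpha> < 1"
    and abs_rv: "regularly_varying (\<lambda>x. \<P>(\<omega> in P. \<bar>Y 0 \<omega>\<bar> > x)) (-\<alpha>)"
    and ratio: "((\<lambda>x. \<P>(\<omega> in P. Y 0 \<omega> > x) / \<P>(\<omega> in P. \<bar>Y 0 \<omega>\<bar> > x)) \<longlongrightarrow> p) at_top" and p: "0 < p"
    and local_reg: "local_tail_regularity \<alpha> P (Y 0)"
begin

section \<open>Tails of Y and |Y|, and the growth of M_n\<close>

definition abs_tail :: "real \<Rightarrow> real" where
  "abs_tail x = \<P>(\<omega> in P. x < \<bar>Y 0 \<omega>\<bar>)"

lemma abs_tail_antimono: "x \<le> y \<Longrightarrow> abs_tail y \<le> abs_tail x"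
  unfolding abs_tail_def by (intro finite_measure_mono) auto

lemma abs_tail_pos: "0 < abs_tail x"
proof -
  obtain a where a: "\<forall>x\<ge>a. 0 < abs_tail x"
    using abs_rv unfolding regularly_varying_def abs_tail_def by blast
  have "0 < abs_tail (max a x)" using a by simp
  also have "\<dots> \<le> abs_tail x" by (rule abs_tail_antimono) simp
  finally show ?thesis .
qed

lemma abs_tail_lim: "0 < s \<Longrightarrow> ((\<lambda>x. abs_tail (s * x) / abs_tail x) \<longlongrightarrow> s powr -\<alpha>) at_top"
  using abs_rv unfolding regularly_varying_def abs_tail_def by blast

lemma tail_ratio: "((\<lambda>x. tail x / abs_tail x) \<longlongrightarrow> p) at_top"
  using ratio unfolding tail_def abs_tail_def .

lemma tail_pos: "0 < tail x"
proof -
  have "\<forall>\<^sub>F y in at_top. 0 < tail y / abs_tail y"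
    using tail_ratio p by (rule order_tendstoD)
  then obtain b where b: "\<forall>y\<ge>b. 0 < tail y / abs_tail y" by (auto simp only: eventually_at_top_linorder)
  define y where "y = max b x"
  have y: "0 < tail y / abs_tail y" "x \<le> y" using b by (simp_all add: y_def)
  then have "0 < tail y" using abs_tail_pos[of y] by (simp add: zero_less_divide_iff)
  then show ?thesis using tail_antimono[OF y(2)] by linarith
qed

text \<open>The right tail inherits the index from |Y|: the quotients \<open>tail / abs_tail\<close>
  at s x and at x have the same positive limit \<open>p\<close>, which cancels.\<close>

lemma tail_lim:
  assumes "0 < s"
  shows "((\<lambda>x. tail (s * x) / tail x) \<longlongrightarrow> s powr -\<alpha>) at_top"
proof -
  have "((\<lambda>x. (tail (s * x) / abs_tail (s * x)) * (abs_tail (s * x) / abs_tail x) / (tail x / abs_tail x)) \<longlongrightarrow>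
      p * s powr -\<alpha> / p) at_top"
    using p by (intro tendsto_intros tail_ratio abs_tail_lim assms
       filterlim_compose[OF tail_ratio filterlim_mult_const_at_top]) auto
  moreover have "(\<lambda>x. (tail (s * x) / abs_tail (s * x)) * (abs_tail (s * x) / abs_tail x) / (tail x / abs_tail x)) = (\<lambda>x. tail (s * x) / tail x)"
  proof
    show "(tail (s * x) / abs_tail (s * x)) * (abs_tail (s * x) / abs_tail x) / (tail x / abs_tail x) = tail (s * x) / tail x" for x
      using abs_tail_pos[of x] abs_tail_pos[of "s * x"] by simp
  qed
  ultimately have "((\<lambda>x. tail (s * x) / tail x) \<longlongrightarrow> p * s powr -\<alpha> / p) at_top" by (simp only:)
  then show ?thesis using p by simp
qed

lemma abs_tail_le_tail: "\<forall>\<^sub>F x in at_top. abs_tail x \<le> 2 / p * tail x"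
proof -
  have "\<forall>\<^sub>F x in at_top. p / 2 < tail x / abs_tail x"
    using p by (intro order_tendstoD[OF tail_ratio]) auto
  then show ?thesis
    using abs_tail_pos p by (auto elim!: eventually_mono simp: field_simps less_imp_le)
qed

lemma small_part_Karamata:
  "\<exists>K>0. \<forall>\<^sub>F x in at_top. expectation (\<lambda>\<omega>. small_part x (Y 0 \<omega>)) \<le> K * (x * tail x)"
proof (rule Karamata_upper_bound[OF tail_pos tail_antimono tail_lim[of "1/2"] \<alpha>(2)])
  show "expectation (\<lambda>\<omega>. small_part x (Y 0 \<omega>)) \<le>
      expectation (\<lambda>\<omega>. small_part (x / 2) (Y 0 \<omega>)) + x * tail (x / 2)" if "0 < x" for x
    unfolding tail_def using that by (intro expectation_small_part_halving) auto
  show "expectation (\<lambda>\<omega>. small_part x (Y 0 \<omega>)) \<le> x" if "0 \<le> x" for x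
    using that by (intro expectation_small_part_le) auto
qed auto

lemma abs_small_part_Karamata:
  "\<exists>K>0. \<forall>\<^sub>F x in at_top. expectation (\<lambda>\<omega>. small_part x \<bar>Y 0 \<omega>\<bar>) \<le> K * (x * abs_tail x)"
proof (rule Karamata_upper_bound[OF abs_tail_pos abs_tail_antimono abs_tail_lim[of "1/2"] \<alpha>(2)])
  show "expectation (\<lambda>\<omega>. small_part x \<bar>Y 0 \<omega>\<bar>) \<le>
      expectation (\<lambda>\<omega>. small_part (x / 2) \<bar>Y 0 \<omega>\<bar>) + x * abs_tail (x / 2)" if "0 < x" for x
    unfolding abs_tail_def using that by (intro expectation_small_part_halving) auto
  show "expectation (\<lambda>\<omega>. small_part x \<bar>Y 0 \<omega>\<bar>) \<le> x" if "0 \<le> x" for x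
    using that by (intro expectation_small_part_le) auto
qed auto

text \<open>The local condition is taken with \<delta> = 1 and b = 1. With z = r / m and \<alpha> <
  1, the term (1 - z)^(-\<alpha>) - 1 is at most 1/(1 - z) - 1 = z/(1 - z), which is at most z/(1 -
  u); the condition adds another z. This explains C = 1/(1 - u) + 1.\<close>

lemma tail_near_threshold:
  "\<exists>C\<ge>0. \<exists>u>0. u < 1 \<and> (\<forall>\<^sub>F m in at_top. \<forall>r. 0 \<le> r \<longrightarrow> r \<le> u * m \<longrightarrow> tail (m - r) - tail m \<le> C * tail m * (r / m))"
proof -
  obtain T0 u where T0: "T0 > 0" and u: "0 < u" "u < 1"
    and reg: "\<And>T a b. T \<ge> T0 \<Longrightarrow> 1 - u \<le> a \<Longrightarrow> a \<le> b \<Longrightarrow> b \<le> 1 \<Longrightarrow>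
      \<bar>(tail (a * T) - tail (b * T)) / tail T - (a powr (-\<alpha>) - b powr (-\<alpha>))\<bar> \<le> 1 * (b - a)"
    using local_reg[unfolded local_tail_regularity_def, rule_format, of 1] unfolding tail_def by auto
  define C where "C = 1 / (1 - u) + 1"
  have "tail (m - r) - tail m \<le> C * tail m * (r / m)" if m: "m \<ge> T0" and r: "0 \<le> r" "r \<le> u * m" for m r
  proof -
    have "0 < m" using T0 m by simp
    define z where "z = r / m"
    have z: "0 \<le> z" "z \<le> u" using r \<open>0 < m\<close> by (auto simp: z_def field_simps)
    have eq: "(1 - z) * m = m - r" using \<open>0 < m\<close> by (simp add: z_def field_simps)
    have "(tail (m - r) - tail m) / tail m \<le> ((1 - z) powr -\<alpha> - 1) + z"
      using reg[OF m, of "1 - z" 1] z by (auto simp: eq abs_le_iff)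
    also have "(1 - z) powr -\<alpha> \<le> (1 - z) powr - 1"
      using z u \<alpha> by (intro powr_mono') auto
    also have "(1 - z) powr - 1 - 1 = z * (1 / (1 - z))"
      using z u by (simp add: powr_minus_divide field_simps)
    also have "z * (1 / (1 - z)) \<le> z * (1 / (1 - u))"
      using z u by (intro mult_left_mono divide_left_mono) auto
    finally have "(tail (m - r) - tail m) / tail m \<le> C * z" by (simp add: C_def algebra_simps)
    then have "tail (m - r) - tail m \<le> C * z * tail m" using tail_pos[of m] by (simp add: pos_divide_le_eq)
    then show ?thesis by (simp add: z_def mult_ac)
  qed
  moreover have "0 \<le> C" using u by (simp add: C_def)
  ultimately show ?thesis using u by (intro exI[of _ C] conjI exI[of _ u]) (auto simp: eventually_at_top_linorder)
qed

text \<open>Potter's bound with exponent \<alpha> b < \<alpha> gives n tail(M_n) \<le> C n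
  M_n^(-\<alpha> b), and the right-hand side is C (M_n^b / n^(1/\<alpha>))^(-\<alpha>).\<close>

lemma tail_mult_tendsto_0:
  assumes M: "filterlim M at_top sequentially" and M_pos: "\<And>n. 1 \<le> n \<Longrightarrow> 0 < M n" and "0 < b" "b < 1"
    and much: "much_greater (\<lambda>n. M n powr b) (\<lambda>n. real n powr (1 / \<alpha>))"
  shows "(\<lambda>n. real n * tail (M n)) \<longlonglongrightarrow> 0"
proof -
  obtain C where C: "0 < C" "\<forall>\<^sub>F x in at_top. tail x \<le> C * x powr -(\<alpha> * b)"
    using Potter_upper_bound[OF tail_pos tail_le_1 tail_lim[of "1/2"], of "\<alpha> * b"] \<alpha> \<open>0 < b\<close> \<open>b < 1\<close> by auto
  let ?u = "\<lambda>n. M n powr b / real n powr (1 / \<alpha>)"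
  have lim: "(\<lambda>n. C * ?u n powr -\<alpha>) \<longlonglongrightarrow> C * 0"
    using much \<alpha> unfolding much_greater_def
    by (intro tendsto_mult tendsto_const tendsto_neg_powr) auto
  have "\<forall>\<^sub>F n in sequentially. real n * tail (M n) \<le> C * ?u n powr -\<alpha>"
    using eventually_compose_filterlim[OF C(2) M] eventually_gt_at_top[of 0]
  proof eventually_elim
    case (elim n)
    then have "0 < M n" using M_pos by simp
    have "real n * tail (M n) \<le> real n * (C * M n powr -(\<alpha> * b))" using elim by (intro mult_left_mono) auto
    also have "?u n powr -\<alpha> = M n powr -(\<alpha> * b) * real n"
      using \<open>0 < M n\<close> elim \<alpha> by (simp add: powr_divide powr_powr powr_minus field_simps)
    then have "real n * (C * M n powr -(\<alpha> * b)) = C * ?u n powr -\<alpha>" by simp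
    finally show ?case .
  qed
  moreover have "\<forall>\<^sub>F n in sequentially. 0 \<le> real n * tail (M n)"
    using tail_nonneg by (intro always_eventually) auto
  ultimately show ?thesis using lim by (auto intro: tendsto_sandwich[OF _ _ tendsto_const])
qed

text \<open>For n \<ge> 1 the comparison sequence is at least 1, so M_n^b itself tends to
  infinity.\<close>

lemma much_greater_imp_at_top:
  assumes "0 < b" and much: "much_greater (\<lambda>n. M n powr b) (\<lambda>n. real n powr (1 / \<alpha>))"
    and M_pos: "\<And>n. 1 \<le> n \<Longrightarrow> 0 < M n"
  shows "filterlim M at_top sequentially"
  unfolding filterlim_at_top_gt[of _ _ "0 :: real"]
proof safe
  fix Z :: real assume "0 < Z"
  have "\<forall>\<^sub>F n in sequentially. Z powr b \<le> M n powr b / real n powr (1 / \<alpha>)"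
    using much unfolding much_greater_def filterlim_at_top by blast
  then show "\<forall>\<^sub>F n in sequentially. Z \<le> M n"
    using eventually_ge_at_top[of 1]
  proof eventually_elim
    case (elim n)
    have "1 \<le> real n powr (1 / \<alpha>)" using elim \<alpha> by (intro ge_one_powr_ge_zero) auto
    then have "M n powr b / real n powr (1 / \<alpha>) \<le> M n powr b / 1"
      using elim by (intro divide_left_mono) auto
    then have "Z powr b \<le> M n powr b" using elim by simp
    moreover have "M n powr b < Z powr b" if "M n < Z"
      using \<open>0 < b\<close> M_pos[of n] elim that by (intro powr_less_mono2) auto
    ultimately show "Z \<le> M n" by (meson not_less)
  qed
qed

definition limit_const :: "nat \<Rightarrow> real" where
  "limit_const k = enn2real (conv_tail (jump_measure \<alpha> 0) (Suc k) (real k))"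

section \<open>Matching upper and lower bounds for fixed k\<close>

context
  fixes M :: "nat \<Rightarrow> real" and k :: nat
  assumes M: "filterlim M at_top sequentially" and M_pos: "\<And>n. 1 \<le> n \<Longrightarrow> 0 < M n"
    and rare: "(\<lambda>n. real n * tail (M n)) \<longlonglongrightarrow> 0" and k: "1 \<le> k"
begin

text \<open>Finiteness of the tail matters here as well as its positivity, since
  \<open>enn2real\<close> sends infinity to 0.\<close>

lemma limit_const_pos: "0 < limit_const k"
  using conv_tail_jump_pos[OF \<alpha>(1), of "real k" "Suc k"] conv_tail_jump_finite_at_pred[OF \<alpha> k]
  unfolding limit_const_def by (simp add: enn2real_positive_iff del: conv_tail.simps)

lemma M_ev_pos: "\<forall>\<^sub>F n in sequentially. 0 < M n"
  using eventually_ge_at_top[of 1] by (rule eventually_mono) (rule M_pos)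

lemma tail_M_lim: "0 < s \<Longrightarrow> (\<lambda>n. tail (s * M n) / tail (M n)) \<longlonglongrightarrow> s powr -\<alpha>"
  by (rule filterlim_compose[OF tail_lim M])

lemma window_prob_ev:
  assumes "0 < \<epsilon>" "\<epsilon> \<le> 1" "0 < \<delta>"
  shows window_prob_le_ev: "\<forall>\<^sub>F n in sequentially. \<forall>I. finite I \<longrightarrow> card I = j \<longrightarrow>
      window_prob \<epsilon> (M n) t I \<le> (enn2real (conv_tail (jump_measure \<alpha> \<epsilon>) j (t - \<delta>)) + \<delta>) * tail (M n) ^ j"
    and window_prob_ge_ev: "\<forall>\<^sub>F n in sequentially. \<forall>I. finite I \<longrightarrow> card I = j \<longrightarrow>
      (enn2real (conv_tail (jump_measure \<alpha> \<epsilon>) j (t + \<delta>)) - \<delta>) * tail (M n) ^ j \<le> window_prob \<epsilon> (M n) t I"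
proof -
  have "\<forall>\<^sub>F n in sequentially. \<forall>I. finite I \<longrightarrow> card I = j \<longrightarrow>
    window_prob \<epsilon> (M n) t I \<le> (enn2real (conv_tail (jump_measure \<alpha> \<epsilon>) j (t - \<delta>)) + \<delta>) * tail (M n) ^ j \<and>
    (enn2real (conv_tail (jump_measure \<alpha> \<epsilon>) j (t + \<delta>)) - \<delta>) * tail (M n) ^ j \<le> window_prob \<epsilon> (M n) t I"
    by (rule window_prob_bounds_ev[OF M_ev_pos tail_pos _ \<alpha>(1) assms]) (rule tail_M_lim)
  then show "\<forall>\<^sub>F n in sequentially. \<forall>I. finite I \<longrightarrow> card I = j \<longrightarrow>
      window_prob \<epsilon> (M n) t I \<le> (enn2real (conv_tail (jump_measure \<alpha> \<epsilon>) j (t - \<delta>)) + \<delta>) * tail (M n) ^ j"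
    and "\<forall>\<^sub>F n in sequentially. \<forall>I. finite I \<longrightarrow> card I = j \<longrightarrow>
      (enn2real (conv_tail (jump_measure \<alpha> \<epsilon>) j (t + \<delta>)) - \<delta>) * tail (M n) ^ j \<le> window_prob \<epsilon> (M n) t I"
    by (auto elim!: eventually_mono)
qed

text \<open>The error \<eta> is split into thirds: for the main coefficient (by the choice of
  \<delta>), for \<open>C ^ k * L\<close> (by the choice of \<epsilon>), and for the higher order
  terms (by taking n large).\<close>

lemma prob_truncated_sum_upper:
  assumes "0 < \<eta>"
  shows "\<forall>\<^sub>F n in sequentially. \<P>(\<omega> in P. truncated_sum Y M n \<omega> > real k * M n) \<le>
    (limit_const k / fact (k + 1) + \<eta>) * (real n * tail (M n)) ^ (k + 1)"
proof -
  obtain K where K: "0 < K" "\<forall>\<^sub>F x in at_top. expectation (\<lambda>\<omega>. small_part x (Y 0 \<omega>)) \<le> K * (x * tail x)"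
    using small_part_Karamata by blast
  obtain C u where C: "0 \<le> C" and u: "0 < u" "u < 1" and near: "\<forall>\<^sub>F m in at_top. \<forall>r. 0 \<le> r \<longrightarrow> r \<le> u * m \<longrightarrow> tail (m - r) - tail m \<le> C * tail m * (r / m)"
    using tail_near_threshold by blast
  \<comment> \<open>This solves (2 K C^k + 1) e0^(1-\<alpha>) = \<eta>/3; the added 1 avoids
    division by zero when C = 0.\<close>
  define e0 where "e0 = (\<eta> / (3 * (C ^ k * (2 * K) + 1))) powr (1 / (1 - \<alpha>))"
  define \<epsilon> where "\<epsilon> = min e0 (min (u / 2) (1 / (real k + 2)))"
  have CK: "0 < C ^ k * (2 * K) + 1" using C K by (simp add: add_nonneg_pos)
  have e0: "0 < e0" using CK \<open>0 < \<eta>\<close> by (simp add: e0_def)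
  have "\<epsilon> \<le> 1 / (real k + 2)" by (simp add: \<epsilon>_def)
  then have \<epsilon>k: "(real k + 2) * \<epsilon> \<le> 1" by (simp add: field_simps)
  have \<epsilon>: "0 < \<epsilon>" "2 * \<epsilon> \<le> u" "\<epsilon> \<le> 1" "\<epsilon> \<le> e0"
    using e0 u by (auto simp: \<epsilon>_def)
  \<comment> \<open>Twice the limit of tail(\<epsilon> M_n) / tail(M_n), so the bound holds
    eventually. Then L = K \<epsilon> B comes from Karamata's bound at \<epsilon> M_n.\<close>
  define B where "B = 2 * \<epsilon> powr -\<alpha>"
  define L where "L = 2 * K * \<epsilon> powr (1 - \<alpha>)"
  have BL: "0 < B" "0 < L" "K * (\<epsilon> * B) = L" using \<epsilon> K by (auto simp: B_def L_def powr_diff powr_minus field_simps)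
  have CL: "C ^ k * L \<le> \<eta> / 3"
  proof -
    have "\<epsilon> powr (1 - \<alpha>) \<le> e0 powr (1 - \<alpha>)" using \<epsilon> \<alpha> by (intro powr_mono2) auto
    also have "\<dots> = \<eta> / (3 * (C ^ k * (2 * K) + 1))" using \<alpha> \<open>0 < \<eta>\<close> CK by (simp add: e0_def powr_powr)
    finally have "(C ^ k * (2 * K)) * \<epsilon> powr (1 - \<alpha>) \<le> (C ^ k * (2 * K)) * (\<eta> / (3 * (C ^ k * (2 * K) + 1)))"
      using C K by (intro mult_left_mono) auto
    then have "C ^ k * L \<le> (C ^ k * (2 * K)) * (\<eta> / (3 * (C ^ k * (2 * K) + 1)))"
      by (simp only: L_def mult.assoc)
    also have "\<dots> \<le> (C ^ k * (2 * K) + 1) * (\<eta> / (3 * (C ^ k * (2 * K) + 1)))"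
      using \<open>0 < \<eta>\<close> CK by (intro mult_right_mono) auto
    also have "\<dots> = \<eta> / 3" using nonzero_mult_divide_mult_cancel_left[of "C ^ k * (2 * K) + 1" \<eta> 3] CK
      by (simp only: times_divide_eq_right mult.commute[of 3])
    finally show ?thesis .
  qed
  let ?d = "\<lambda>t. enn2real (conv_tail (jump_measure \<alpha> \<epsilon>) (Suc k) t)"
  obtain C' where C': "0 \<le> C'" "\<And>t h. 0 \<le> h \<Longrightarrow> conv_tail (jump_measure \<alpha> \<epsilon>) (Suc k) (t - h) \<le>
      conv_tail (jump_measure \<alpha> \<epsilon>) (Suc k) t + ennreal (C' * h)"
    using conv_tail_jump_Lipschitz[OF \<alpha>(1) \<epsilon>(1,3), of k] by blast
  \<comment> \<open>Two shifts by \<delta> occur, one in the level k - \<delta> of the window and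
    one in \<open>window_prob_le_ev\<close>, which also adds \<delta>. The total cost is 2 C'
    \<delta> + \<delta> = \<eta>/3.\<close>
  define \<delta> where "\<delta> = \<eta> / (3 * (2 * C' + 1))"
  have \<delta>: "0 < \<delta>" "C' * (2 * \<delta>) + \<delta> = \<eta> / 3"
  proof -
    have W: "0 < 2 * C' + 1" using C'(1) by simp
    have "\<eta> / (3 * w) * w = \<eta> / 3" if "0 < w" for w :: real using that by simp
    from this[OF W] have "\<delta> * (2 * C' + 1) = \<eta> / 3" unfolding \<delta>_def .
    then show "C' * (2 * \<delta>) + \<delta> = \<eta> / 3" by (simp add: algebra_simps)
    show "0 < \<delta>" unfolding \<delta>_def using W \<open>0 < \<eta>\<close> by (intro divide_pos_pos mult_pos_pos) auto
  qed
  define D where "D = ?d (real k - \<delta> - \<delta>) + \<delta>"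
  have "conv_tail (jump_measure \<alpha> \<epsilon>) (Suc k) (real k - 2 * \<delta>) \<le> conv_tail (jump_measure \<alpha> 0) (Suc k) (real k) + ennreal (C' * (2 * \<delta>))"
    using C'(2)[of "2 * \<delta>" "real k"] \<delta> conv_tail_jump_mono[of 0 \<epsilon> \<alpha> "Suc k" "real k"] \<epsilon>
    by (meson add_right_mono less_imp_le order_trans mult_nonneg_nonneg zero_le_numeral)
  also have "\<dots> = ennreal (limit_const k + C' * (2 * \<delta>))"
    using conv_tail_jump_finite_at_pred[OF \<alpha> k] C'(1) \<delta>(1) unfolding limit_const_def
    by (simp add: ennreal_plus del: conv_tail.simps)
  finally have "?d (real k - 2 * \<delta>) \<le> limit_const k + C' * (2 * \<delta>)"
    using limit_const_pos C'(1) \<delta>(1) by (intro enn2real_leI) auto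
  then have D: "D \<le> limit_const k + \<eta> / 3" using \<delta>(2) by (simp add: D_def algebra_simps del: conv_tail.simps)
  have D0: "0 \<le> D" using \<delta>(1) by (simp add: D_def del: conv_tail.simps)
  define H where "H = B ^ (k + 2) + B ^ (k + 1) * L / \<delta> + B ^ k * (exp 1 * (L / \<epsilon>) ^ 2) + exp 1 * (L / \<epsilon>) ^ (k + 2)"
  have "(\<lambda>n. H * (real n * tail (M n))) \<longlonglongrightarrow> H * 0" by (intro tendsto_mult tendsto_const rare)
  then have Hx: "\<forall>\<^sub>F n in sequentially. H * (real n * tail (M n)) < \<eta> / 3"
    using \<open>0 < \<eta>\<close> by (intro order_tendstoD) auto
  have wind: "\<forall>\<^sub>F n in sequentially. \<forall>I. finite I \<longrightarrow> card I = Suc k \<longrightarrow>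
      window_prob \<epsilon> (M n) (real k - \<delta>) I \<le> D * tail (M n) ^ Suc k"
    unfolding D_def
    by (rule window_prob_le_ev[OF \<epsilon>(1,3) \<delta>(1)])
  have big: "\<forall>\<^sub>F n in sequentially. tail (\<epsilon> * M n) / tail (M n) < B"
    using \<epsilon> by (intro order_tendstoD(2)[OF tail_M_lim]) (auto simp: B_def)
  have small: "\<forall>\<^sub>F n in sequentially. expectation (\<lambda>\<omega>. small_part (\<epsilon> * M n) (Y 0 \<omega>)) \<le> K * (\<epsilon> * M n * tail (\<epsilon> * M n))"
    by (rule eventually_compose_filterlim[OF K(2) filterlim_compose[OF filterlim_mult_const_at_top[OF \<epsilon>(1)] M]])
  show ?thesis
    using Hx wind big small eventually_compose_filterlim[OF near M] eventually_ge_at_top[of 1]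
  proof eventually_elim
    case (elim n)
    let ?q = "tail (M n)" and ?x = "real n * tail (M n)"
    have m: "0 < M n" using elim M_pos by simp
    have q: "0 < ?q" by (rule tail_pos)
    have big': "tail (\<epsilon> * M n) \<le> B * ?q" using elim q by (simp add: field_simps)
    have "K * (\<epsilon> * M n * tail (\<epsilon> * M n)) \<le> K * (\<epsilon> * M n * (B * ?q))"
      using big' K \<epsilon> m by (intro mult_left_mono) auto
    also have "\<dots> = (K * (\<epsilon> * B)) * (M n * ?q)" by (simp only: mult_ac)
    finally have small': "expectation (\<lambda>\<omega>. small_part (\<epsilon> * M n) (Y 0 \<omega>)) \<le> L * (M n * ?q)"
      unfolding BL(3) using elim by linarith
    have "\<P>(\<omega> in P. truncated_sum Y M n \<omega> > real k * M n) \<le> (D / fact (k + 1) + C ^ k * L) * ?x ^ (k + 1) + H * ?x ^ (k + 2)"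
      unfolding truncated_sum_def H_def
    proof (rule prob_truncated_sum_gt_le[OF m \<epsilon>(1,3,2) _ \<epsilon>k \<delta>(1) k elim(6) q _ BL(2) C D0 big' small'])
      show "tail (M n - r) - ?q \<le> C * ?q * (r / M n)" if "0 \<le> r" "r \<le> u * M n" for r
        using elim(5) that by blast
      show "window_prob \<epsilon> (M n) (real k - \<delta>) I \<le> D * ?q ^ (k + 1)" if "finite I" "card I = k + 1" for I
        using elim(2) that by simp
    qed (use u BL in simp_all)
    also have "\<dots> = (D / fact (k + 1) + C ^ k * L + H * ?x) * ?x ^ (k + 1)" by (simp add: algebra_simps)
    also have "\<dots> \<le> (limit_const k / fact (k + 1) + \<eta>) * ?x ^ (k + 1)"
    proof (intro mult_right_mono)
      have "D / fact (k + 1) \<le> (limit_const k + \<eta> / 3) / fact (k + 1)" using D by (intro divide_right_mono) auto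
      also have "\<dots> = limit_const k / fact (k + 1) + \<eta> / 3 / fact (k + 1)" by (rule add_divide_distrib)
      also have "\<eta> / 3 / fact (k + 1) \<le> \<eta> / 3 / 1" using \<open>0 < \<eta>\<close> by (intro divide_left_mono) (auto simp: fact_ge_1 simp del: fact_Suc)
      finally show "D / fact (k + 1) + C ^ k * L + H * ?x \<le> limit_const k / fact (k + 1) + \<eta>" using CL elim by linarith
    qed (use q in auto)
    finally show ?case .
  qed
qed

lemma prob_truncated_sum_lower:
  assumes "0 < \<eta>"
  shows "\<forall>\<^sub>F n in sequentially. (limit_const k / fact (k + 1) - \<eta>) * (real n * tail (M n)) ^ (k + 1) \<le>
    \<P>(\<omega> in P. truncated_sum Y M n \<omega> > real k * M n)"
proof -
  let ?d = "\<lambda>\<epsilon> t. enn2real (conv_tail (jump_measure \<alpha> \<epsilon>) (Suc k) t)"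
  \<comment> \<open>The constant will lose 2 \<eta>'. The first bound keeps this below \<eta>, the
    second keeps what is left nonnegative.\<close>
  define \<eta>' where "\<eta>' = min (\<eta> / 3) (limit_const k / 4)"
  have \<eta>': "0 < \<eta>'" "\<eta>' \<le> \<eta> / 3" "\<eta>' \<le> limit_const k / 4" using \<open>0 < \<eta>\<close> limit_const_pos by (auto simp: \<eta>'_def)
  define f where "f = (\<lambda>n. conv_tail (jump_measure \<alpha> (1 / real (Suc n))) (Suc k) (real k + 1 / real (Suc n)))"
  have "ennreal (limit_const k - \<eta>') < (SUP n. f n)"
  proof -
    have "(SUP n. f n) = conv_tail (jump_measure \<alpha> 0) (Suc k) (real k)"
      unfolding f_def by (rule SUP_conv_tail_jump)
    also have "\<dots> = ennreal (limit_const k)"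
      using conv_tail_jump_finite_at_pred[OF \<alpha> k] by (simp add: limit_const_def del: conv_tail.simps)
    finally show ?thesis using \<eta>' limit_const_pos by (simp add: ennreal_lessI)
  qed
  then obtain n0 where n0: "ennreal (limit_const k - \<eta>') < f n0" unfolding less_SUP_iff by blast
  obtain n1 where n1: "1 / real (Suc n1) < \<eta>'" using reals_Archimedean[OF \<eta>'(1)] by (auto simp: field_simps)
  define N where "N = max n0 n1"
  \<comment> \<open>The window level k + \<epsilon> and the further shift by \<epsilon> in
    \<open>window_prob_ge_ev\<close> add up to k + 1/(N+1). As N \<ge> n0, this level and the cutoff
    are no worse than those in \<open>f n0\<close>; as N \<ge> n1, also \<epsilon> \<le>
    \<eta>'.\<close>
  define \<epsilon> where "\<epsilon> = 1 / real (Suc N) / 2"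
  have le: "1 / real (Suc N) \<le> 1 / real (Suc n0)" "1 / real (Suc N) \<le> 1 / real (Suc n1)"
    by (auto simp: N_def intro!: divide_left_mono)
  have "x / 2 \<le> x" if "0 \<le> x" for x :: real using that by simp
  then have "\<epsilon> \<le> 1 / real (Suc N)" unfolding \<epsilon>_def by (metis of_nat_0_le_iff zero_le_divide_1_iff)
  then have \<epsilon>: "0 < \<epsilon>" "\<epsilon> \<le> 1" "\<epsilon> \<le> \<eta>'" using le(2) n1 by (auto simp: \<epsilon>_def)
  have \<epsilon>2: "\<epsilon> + \<epsilon> = 1 / real (Suc N)" unfolding \<epsilon>_def by (rule field_sum_of_halves)
  have "f n0 \<le> conv_tail (jump_measure \<alpha> \<epsilon>) (Suc k) (real k + 1 / real (Suc n0))"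
    unfolding f_def using le(1) by (intro conv_tail_jump_mono) (auto simp: \<epsilon>_def field_simps)
  also have "\<dots> \<le> conv_tail (jump_measure \<alpha> \<epsilon>) (Suc k) (real k + \<epsilon> + \<epsilon>)"
    using le(1) \<epsilon>2 by (intro conv_tail_antimono) linarith
  finally have "ennreal (limit_const k - \<eta>') \<le> conv_tail (jump_measure \<alpha> \<epsilon>) (Suc k) (real k + \<epsilon> + \<epsilon>)"
    using n0 by (meson less_le_trans less_imp_le)
  then have d: "limit_const k - \<eta>' \<le> ?d \<epsilon> (real k + \<epsilon> + \<epsilon>)"
  proof -
    assume le: "ennreal (limit_const k - \<eta>') \<le> conv_tail (jump_measure \<alpha> \<epsilon>) (Suc k) (real k + \<epsilon> + \<epsilon>)"
    have "enn2real (ennreal (limit_const k - \<eta>')) \<le> ?d \<epsilon> (real k + \<epsilon> + \<epsilon>)"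
      by (rule enn2real_mono[OF le]) (rule conv_tail_jump_finite[OF \<alpha>(1) \<epsilon>(1,2), unfolded infinity_ennreal_def])
    moreover have "0 \<le> limit_const k - \<eta>'" using \<eta>' limit_const_pos by linarith
    ultimately show ?thesis by (simp only: enn2real_ennreal)
  qed
  \<comment> \<open>One \<eta>' for approximating the constant, one for the additive error
    \<epsilon> of the window bound.\<close>
  define w where "w = limit_const k - 2 * \<eta>'"
  have w: "0 \<le> w" using \<eta>' limit_const_pos by (simp add: w_def)
  obtain K where K: "0 < K" "\<forall>\<^sub>F x in at_top. expectation (\<lambda>\<omega>. small_part x \<bar>Y 0 \<omega>\<bar>) \<le> K * (x * abs_tail x)"
    using abs_small_part_Karamata by blast
  \<comment> \<open>The 1 accounts for absolute values beyond M_n, K / \<epsilon> for Markov's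
    inequality at level \<epsilon> M_n, and 2 / p converts the tail of |Y| into that of Y.\<close>
  define H where "H = (1 + K / \<epsilon>) * (2 / p)"
  have "0 \<le> H" using K \<epsilon> p by (simp add: H_def)
  have Hlim: "(\<lambda>n. H * (real n * tail (M n))) \<longlonglongrightarrow> H * 0" by (intro tendsto_mult tendsto_const rare)
  then have Hx: "\<forall>\<^sub>F n in sequentially. H * (real n * tail (M n)) < 1"
    by (intro order_tendstoD) auto
  have "(\<lambda>n. real (n choose (k + 1)) / real n ^ (k + 1) * (w * (1 - H * (real n * tail (M n))))) \<longlonglongrightarrow>
     1 / fact (k + 1) * (w * (1 - H * 0))"
    by (intro tendsto_mult binomial_div_power_tendsto tendsto_const tendsto_diff rare)
  moreover have "limit_const k / fact (k + 1) - \<eta> < 1 / fact (k + 1) * (w * (1 - H * 0))"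
  proof -
    have "2 * \<eta>' / fact (k + 1) \<le> 2 * \<eta>' / 1" using \<eta>' by (intro divide_left_mono) (auto simp: fact_ge_1 simp del: fact_Suc)
    also have "\<dots> < \<eta>" using \<eta>' by simp
    finally show ?thesis by (simp add: w_def diff_divide_distrib del: fact_Suc)
  qed
  ultimately have main: "\<forall>\<^sub>F n in sequentially. limit_const k / fact (k + 1) - \<eta> <
      real (n choose (k + 1)) / real n ^ (k + 1) * (w * (1 - H * (real n * tail (M n))))"
    by (rule order_tendstoD)
  have wind: "\<forall>\<^sub>F n in sequentially. \<forall>I. finite I \<longrightarrow> card I = Suc k \<longrightarrow>
      w * tail (M n) ^ Suc k \<le> window_prob \<epsilon> (M n) (real k + \<epsilon>) I"
    using window_prob_ge_ev[OF \<epsilon>(1,2) \<epsilon>(1), of "Suc k" "real k + \<epsilon>"]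
  proof (rule eventually_mono, intro allI impI)
    fix n and I :: "nat set" assume *: "finite I" "card I = Suc k"
      "\<forall>I. finite I \<longrightarrow> card I = Suc k \<longrightarrow>
         (?d \<epsilon> (real k + \<epsilon> + \<epsilon>) - \<epsilon>) * tail (M n) ^ Suc k \<le> window_prob \<epsilon> (M n) (real k + \<epsilon>) I"
    have "w * tail (M n) ^ Suc k \<le> (?d \<epsilon> (real k + \<epsilon> + \<epsilon>) - \<epsilon>) * tail (M n) ^ Suc k"
      using d \<epsilon>(3) tail_nonneg unfolding w_def by (intro mult_right_mono) auto
    also have "\<dots> \<le> window_prob \<epsilon> (M n) (real k + \<epsilon>) I" using *(3)[rule_format, OF *(1,2)] .
    finally show "w * tail (M n) ^ Suc k \<le> window_prob \<epsilon> (M n) (real k + \<epsilon>) I" .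
  qed
  show ?thesis
    using main Hx wind eventually_compose_filterlim[OF K(2) M] eventually_compose_filterlim[OF abs_tail_le_tail M]
      eventually_ge_at_top[of 1]
  proof eventually_elim
    case (elim n)
    let ?q = "tail (M n)" and ?x = "real n * tail (M n)"
    have m: "0 < M n" using elim M_pos by simp
    have q: "0 < ?q" by (rule tail_pos)
    have "real n * abs_tail (M n) + real n * expectation (\<lambda>\<omega>. small_part (M n) \<bar>Y 0 \<omega>\<bar>) / (\<epsilon> * M n) \<le>
       real n * abs_tail (M n) + real n * (K * (M n * abs_tail (M n))) / (\<epsilon> * M n)"
      using elim m \<epsilon> by (intro add_left_mono divide_right_mono mult_left_mono) auto
    also have "\<dots> = (1 + K / \<epsilon>) * (real n * abs_tail (M n))" using m \<epsilon> by (simp add: field_simps)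
    also have "\<dots> \<le> (1 + K / \<epsilon>) * (real n * (2 / p * ?q))" using elim K \<epsilon> by (intro mult_left_mono) auto
    also have "\<dots> = H * ?x" by (simp add: H_def)
    finally have rest: "real n * \<P>(\<omega> in P. \<bar>Y 0 \<omega>\<bar> > M n) + real n * expectation (\<lambda>\<omega>. small_part (M n) \<bar>Y 0 \<omega>\<bar>) / (\<epsilon> * M n) \<le> H * ?x"
      by (simp add: abs_tail_def)
    have "(limit_const k / fact (k + 1) - \<eta>) * ?x ^ (k + 1) \<le>
      real (n choose (k + 1)) / real n ^ (k + 1) * (w * (1 - H * ?x)) * ?x ^ (k + 1)"
      using elim q by (intro mult_right_mono) auto
    also have "\<dots> = real (n choose (k + 1)) * (w * ?q ^ (k + 1) * (1 - H * ?x))"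
      using elim by (simp add: power_mult_distrib)
    also have "\<dots> \<le> \<P>(\<omega> in P. truncated_sum Y M n \<omega> > real k * M n)"
      unfolding truncated_sum_def
      by (rule prob_truncated_sum_gt_ge) (use m \<epsilon> w q elim rest in auto)
    finally show ?case .
  qed
qed

lemma prob_truncated_sum_asymp:
  "(\<lambda>n. \<P>(\<omega> in P. truncated_sum Y M n \<omega> > real k * M n) /
     (limit_const k / fact (k + 1) * real n ^ (k + 1) * tail (M n) ^ (k + 1))) \<longlonglongrightarrow> 1"
proof -
  define c where "c = limit_const k / fact (k + 1)"
  have c: "0 < c" using limit_const_pos by (simp add: c_def)
  let ?x = "\<lambda>n. real n * tail (M n)" and ?p = "\<lambda>n. \<P>(\<omega> in P. truncated_sum Y M n \<omega> > real k * M n)"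
  have "(\<lambda>n. ?p n / ?x n ^ (k + 1)) \<longlonglongrightarrow> c"
  proof (rule tendstoI)
    fix \<eta> :: real assume "0 < \<eta>"
    then have "0 < \<eta> / 2" by simp
    show "\<forall>\<^sub>F n in sequentially. dist (?p n / ?x n ^ (k + 1)) c < \<eta>"
      using prob_truncated_sum_upper[OF \<open>0 < \<eta> / 2\<close>] prob_truncated_sum_lower[OF \<open>0 < \<eta> / 2\<close>] eventually_ge_at_top[of 1]
    proof eventually_elim
      case (elim n)
      have "0 < ?x n ^ (k + 1)" using elim tail_pos by simp
      then have "?p n / ?x n ^ (k + 1) \<le> c + \<eta> / 2" "c - \<eta> / 2 \<le> ?p n / ?x n ^ (k + 1)"
        using elim unfolding c_def by (simp_all only: pos_divide_le_eq pos_le_divide_eq)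
      then show ?case using \<open>0 < \<eta>\<close> by (auto simp: dist_real_def abs_less_iff)
    qed
  qed
  then have "(\<lambda>n. ?p n / ?x n ^ (k + 1) / c) \<longlonglongrightarrow> c / c"
    using c by (intro tendsto_divide tendsto_const) auto
  moreover have "?p n / ?x n ^ (k + 1) / c = ?p n / (c * real n ^ (k + 1) * tail (M n) ^ (k + 1))" for n
    by (simp only: power_mult_distrib divide_divide_eq_left mult_ac)
  moreover have "c / c = 1" using c by simp
  ultimately show ?thesis unfolding c_def[symmetric] by (simp only:)
qed

end

end

theorem theorem3p1:
  fixes P :: "'a measure" and Y :: "nat \<Rightarrow> 'a \<Rightarrow> real" and M :: "nat \<Rightarrow> real" and \<alpha> p :: real
  assumes "0 < \<alpha>" and "\<alpha> < 1"
  shows "(\<forall>k\<ge>1. c_fun \<alpha> (k + 1) (real k) < \<infinity>) \<and>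
    (prob_space P \<and> iid_real P Y \<and>
     regularly_varying (\<lambda>x. \<P>(\<omega> in P. \<bar>Y 0 \<omega>\<bar> > x)) (-\<alpha>) \<and>
     ((\<lambda>x. \<P>(\<omega> in P. Y 0 \<omega> > x) / \<P>(\<omega> in P. \<bar>Y 0 \<omega>\<bar> > x)) \<longlongrightarrow> p) at_top \<and> 0 < p \<and>
     local_tail_regularity \<alpha> P (Y 0) \<and>
     (\<forall>n\<ge>1. 0 < M n)
     \<longrightarrow>
     (\<forall>k\<ge>1. \<forall>\<gamma>. \<alpha> < real k / (real k + 2) \<and>
        0 < \<gamma> \<and> \<gamma> < 1 - \<alpha> * (real k + 2) / real k \<and>
        much_greater (\<lambda>n. M n powr (1 - \<alpha> * (real k + 2) / real k - \<gamma>))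
                     (\<lambda>n. real n powr (1 / \<alpha>))
        \<longrightarrow>
        (\<lambda>n. \<P>(\<omega> in P. truncated_sum Y M n \<omega> > real k * M n) /
             (enn2real (c_fun \<alpha> (k + 1) (real k)) / fact (k + 1) *
              real n ^ (k + 1) * \<P>(\<omega> in P. Y 0 \<omega> > M n) ^ (k + 1)))
          \<longlonglongrightarrow> 1))"
proof -
  have c: "c_fun \<alpha> (k + 1) (real k) = conv_tail (jump_measure \<alpha> 0) (Suc k) (real k)" if "1 \<le> k" for k
    using conv_tail_jump_Suc_eq_c_fun[OF assms(1) that conv_tail_jump_eq_c_fun[OF assms(1) that], of "real k"]
    by (simp del: c_fun.simps conv_tail.simps)
  have fin: "c_fun \<alpha> (k + 1) (real k) < \<infinity>" if "1 \<le> k" for k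
    unfolding c[OF that] by (rule conv_tail_jump_finite_at_pred[OF assms that])
  {
    fix k \<gamma>
    assume "prob_space P" "iid_real P Y" and rv: "regularly_varying (\<lambda>x. \<P>(\<omega> in P. \<bar>Y 0 \<omega>\<bar> > x)) (-\<alpha>)"
      "((\<lambda>x. \<P>(\<omega> in P. Y 0 \<omega> > x) / \<P>(\<omega> in P. \<bar>Y 0 \<omega>\<bar> > x)) \<longlongrightarrow> p) at_top" "0 < p"
      "local_tail_regularity \<alpha> P (Y 0)"
      and M_pos: "\<And>n. 1 \<le> n \<Longrightarrow> 0 < M n" and k: "1 \<le> k" and \<gamma>: "0 < \<gamma>" "\<gamma> < 1 - \<alpha> * (real k + 2) / real k"
      and much: "much_greater (\<lambda>n. M n powr (1 - \<alpha> * (real k + 2) / real k - \<gamma>)) (\<lambda>n. real n powr (1 / \<alpha>))"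
    interpret prob_space P by fact
    interpret heavy_tailed_seq P Y \<alpha> p
      using \<open>iid_real P Y\<close> rv assms by unfold_locales (auto simp: iid_real_def)
    \<comment> \<open>Positivity of \<open>b\<close> is the upper bound on \<gamma>; b < 1 leaves
      the gap between \<alpha> b and \<alpha> that Potter's bound needs.\<close>
    define b where "b = 1 - \<alpha> * (real k + 2) / real k - \<gamma>"
    have "0 < \<alpha> * (real k + 2) / real k" using k assms by simp
    then have b: "0 < b" "b < 1" unfolding b_def using \<gamma> by linarith+
    have M: "filterlim M at_top sequentially"
      using b(1) much[folded b_def] M_pos by (rule much_greater_imp_at_top)
    have rare: "(\<lambda>n. real n * tail (M n)) \<longlonglongrightarrow> 0"
      using M M_pos b much[folded b_def] by (rule tail_mult_tendsto_0)
    have "(\<lambda>n. \<P>(\<omega> in P. truncated_sum Y M n \<omega> > real k * M n) /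
        (limit_const k / fact (k + 1) * real n ^ (k + 1) * tail (M n) ^ (k + 1))) \<longlonglongrightarrow> 1"
      using M M_pos rare k by (rule prob_truncated_sum_asymp)
    then have "(\<lambda>n. \<P>(\<omega> in P. truncated_sum Y M n \<omega> > real k * M n) /
             (enn2real (c_fun \<alpha> (k + 1) (real k)) / fact (k + 1) *
              real n ^ (k + 1) * \<P>(\<omega> in P. Y 0 \<omega> > M n) ^ (k + 1))) \<longlonglongrightarrow> 1"
      unfolding c[OF k] limit_const_def tail_def .
  }
  with fin show ?thesis by blast
qed

end
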